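(* If $\mathcal{Q}$ is a finite generalized quadrangle of order $(4,12)$, then the automorphism group of $\mathcal{Q}$ is not transitive on the points of $\mathcal{Q}$ and is not transitive on the lines of $\mathcal{Q}$.
   Context: A finite generalized quadrangle of order $(s,t)$, with $s,t$ positive integers, is an incidence structure consisting of a finite set $\mathcal{P}$ of points, a finite set $\mathcal{L}$ of lines disjoint from $\mathcal{P}$, and a symmetric point-line incidence relation such that: each point is incident with exactly $t+1$ lines and each line is incident with exactly $s+1$ points; two distinct points are mutually incident with at most one line, and two distinct lines are mutually incident with at most one point; and for each point $P$ and each line $\ell$ not incident with $P$ there is a unique pair $(P',\ell') \in \mathcal{P}\times\mathcal{L}$ such that $P$ is incident with $\ell'$, $\ell'$ is incident with $P'$, and $P'$ is incident with $\ell$. An automorphism of $\mathcal{Q}$ is a permutation of the point set that preserves collinearity (two points are collinear if some line is incident with both); it induces a permutation of the lines preserving incidence, and in this way the automorphism group acts on the lines. *)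

theory Defs
  imports "HOL-Algebra.Group_Action"
begin

text \<open>
  Points and lines carry different types, so they are automatically disjoint, and the
  symmetric incidence relation is recorded as the set of its (point, line) pairs.
  The axioms are vacuous for the structure without points and lines, on which every group acts
  transitively; as usual, a generalized quadrangle is required to have a point.
\<close>

locale generalized_quadrangle =
  fixes P :: "'p set" and L :: "'l set" and I :: "('p \<times> 'l) set" and s t :: nat
  assumes finite_points: "finite P"
    and finite_lines: "finite L"
    and points_nonempty: "P \<noteq> {}"
    and incidence: "I \<subseteq> P \<times> L"
    and s_pos: "0 < s"
    and t_pos: "0 < t"
    and card_lines_on_point: "\<And>x. x \<in> P \<Longrightarrow> card {l \<in> L. (x, l) \<in> I} = t + 1"
    and card_points_on_line: "\<And>l. l \<in> L \<Longrightarrow> card {x \<in> P. (x, l) \<in> I} = s + 1"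
    and at_most_one_line:
      "\<And>x y l m. \<lbrakk>x \<in> P; y \<in> P; x \<noteq> y; l \<in> L; m \<in> L;
        (x, l) \<in> I; (y, l) \<in> I; (x, m) \<in> I; (y, m) \<in> I\<rbrakk> \<Longrightarrow> l = m"
    and at_most_one_point:
      "\<And>l m x y. \<lbrakk>l \<in> L; m \<in> L; l \<noteq> m; x \<in> P; y \<in> P;
        (x, l) \<in> I; (x, m) \<in> I; (y, l) \<in> I; (y, m) \<in> I\<rbrakk> \<Longrightarrow> x = y"
    and unique_projection:
      "\<And>x l. \<lbrakk>x \<in> P; l \<in> L; (x, l) \<notin> I\<rbrakk> \<Longrightarrow>
        \<exists>!(y, m). y \<in> P \<and> m \<in> L \<and> (x, m) \<in> I \<and> (y, m) \<in> I \<and> (y, l) \<in> I"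

definition collinear :: "'l set \<Rightarrow> ('p \<times> 'l) set \<Rightarrow> 'p \<Rightarrow> 'p \<Rightarrow> bool" where
  "collinear L I x y \<longleftrightarrow> (\<exists>l\<in>L. (x, l) \<in> I \<and> (y, l) \<in> I)"

definition automorphisms :: "'p set \<Rightarrow> 'l set \<Rightarrow> ('p \<times> 'l) set \<Rightarrow> ('p \<Rightarrow> 'p) set" where
  "automorphisms P L I =
    {g \<in> Bij P. \<forall>x\<in>P. \<forall>y\<in>P. collinear L I x y \<longleftrightarrow> collinear L I (g x) (g y)}"

definition aut_group :: "'p set \<Rightarrow> 'l set \<Rightarrow> ('p \<times> 'l) set \<Rightarrow> ('p \<Rightarrow> 'p) monoid" where
  "aut_group P L I = BijGroup P \<lparr>carrier := automorphisms P L I\<rparr>"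

text \<open>
  The image of a line \<open>l\<close> is the line whose points are the images of the points of \<open>l\<close>; that it
  exists and is unique is lemma \<open>ex1_image_line\<close> below.
\<close>

definition line_action ::
    "'p set \<Rightarrow> 'l set \<Rightarrow> ('p \<times> 'l) set \<Rightarrow> ('p \<Rightarrow> 'p) \<Rightarrow> 'l \<Rightarrow> 'l" where
  "line_action P L I g =
    (\<lambda>l\<in>L. THE m. m \<in> L \<and> (\<forall>x\<in>P. (x, l) \<in> I \<longleftrightarrow> (g x, m) \<in> I))"

text \<open>
  The predicate \<^term>\<open>transitive_action\<close> includes that the map is a group action. The lemmas
  \<open>group_action_points\<close> and \<open>group_action_lines\<close> show that this holds for the two maps below,
  so that negating it for them negates transitivity only.
\<close>

lemma (in generalized_quadrangle) two_points_on_line: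
  assumes "l \<in> L"
  obtains x y where "x \<in> P" "y \<in> P" "x \<noteq> y" "(x, l) \<in> I" "(y, l) \<in> I"
proof -
  let ?A = "{x \<in> P. (x, l) \<in> I}"
  have c: "2 \<le> card ?A"
    using card_points_on_line[OF assms] s_pos by simp
  then have "\<not> card ?A \<le> Suc 0" by simp
  moreover have "finite ?A" using finite_points by simp
  ultimately obtain x y where "x \<in> ?A" "y \<in> ?A" "x \<noteq> y"
    by (auto simp: card_le_Suc0_iff_eq)
  then show thesis using that by blast
qed

lemma (in generalized_quadrangle) line_eqI:
  assumes "l \<in> L" "m \<in> L" "\<And>x. x \<in> P \<Longrightarrow> (x, l) \<in> I \<longleftrightarrow> (x, m) \<in> I"
  shows "l = m"
  by (metis assms two_points_on_line at_most_one_line)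

lemma (in generalized_quadrangle) collinear_two_imp_on_line:
  assumes "x \<in> P" "y \<in> P" "z \<in> P" "m \<in> L" "x \<noteq> y" "(x, m) \<in> I" "(y, m) \<in> I"
    and "collinear L I x z" "collinear L I y z"
  shows "(z, m) \<in> I"
proof (rule ccontr)
  assume n: "(z, m) \<notin> I"
  obtain k where k: "k \<in> L" "(x, k) \<in> I" "(z, k) \<in> I"
    using assms(8) by (auto simp: collinear_def)
  obtain k' where k': "k' \<in> L" "(y, k') \<in> I" "(z, k') \<in> I"
    using assms(9) by (auto simp: collinear_def)
  obtain u where u: "\<And>q. (case q of (v, w) \<Rightarrow>
      v \<in> P \<and> w \<in> L \<and> (z, w) \<in> I \<and> (v, w) \<in> I \<and> (v, m) \<in> I) \<Longrightarrow> q = u"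
    using unique_projection[OF \<open>z \<in> P\<close> \<open>m \<in> L\<close> n] by (auto elim!: ex1E)
  have "(x, k) = u" "(y, k') = u"
    using assms k k' by (auto intro!: u)
  then show False using \<open>x \<noteq> y\<close> by auto
qed

lemma (in generalized_quadrangle) ex1_image_line:
  assumes g: "g \<in> automorphisms P L I" and l: "l \<in> L"
  shows "\<exists>!m. m \<in> L \<and> (\<forall>x\<in>P. (x, l) \<in> I \<longleftrightarrow> (g x, m) \<in> I)"
proof -
  have bij: "bij_betw g P P"
    and col: "\<And>x y. x \<in> P \<Longrightarrow> y \<in> P \<Longrightarrow> collinear L I x y \<Longrightarrow> collinear L I (g x) (g y)"
    using g by (auto simp: automorphisms_def Bij_def)
  have gP: "\<And>x. x \<in> P \<Longrightarrow> g x \<in> P" using bij by (auto simp: bij_betw_def)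
  obtain x y where xy: "x \<in> P" "y \<in> P" "x \<noteq> y" "(x, l) \<in> I" "(y, l) \<in> I"
    using two_points_on_line[OF l] .
  have ne: "g x \<noteq> g y" using bij xy by (auto simp: bij_betw_def inj_on_def)
  have "collinear L I (g x) (g y)" using col xy l by (auto simp: collinear_def)
  then obtain m where m: "m \<in> L" "(g x, m) \<in> I" "(g y, m) \<in> I"
    by (auto simp: collinear_def)
  let ?A = "{z \<in> P. (z, l) \<in> I}" and ?B = "{z \<in> P. (z, m) \<in> I}"
  have "g ` ?A \<subseteq> ?B"
  proof
    fix w assume "w \<in> g ` ?A"
    then obtain z where z: "z \<in> P" "(z, l) \<in> I" "w = g z" by auto
    have "collinear L I x z" "collinear L I y z"
      using xy z l by (auto simp: collinear_def)
    then have "(g z, m) \<in> I"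
      using collinear_two_imp_on_line[of "g x" "g y" "g z" m] xy z m ne gP col by blast
    then show "w \<in> ?B" using z gP by auto
  qed
  moreover have "card (g ` ?A) = card ?B"
  proof -
    have "inj_on g ?A" using bij by (auto simp: bij_betw_def inj_on_def)
    then show ?thesis
      by (simp add: card_image card_points_on_line[OF l] card_points_on_line[OF m(1)])
  qed
  ultimately have im: "g ` ?A = ?B"
    using finite_points by (intro card_subset_eq) auto
  have ex: "(z, l) \<in> I \<longleftrightarrow> (g z, m) \<in> I" if "z \<in> P" for z
  proof
    assume "(z, l) \<in> I"
    then show "(g z, m) \<in> I" using im that by blast
  next
    assume "(g z, m) \<in> I"
    then have "g z \<in> g ` ?A" using im gP that by blast
    then obtain z' where "z' \<in> P" "(z', l) \<in> I" "g z = g z'" by auto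
    then show "(z, l) \<in> I" using bij that by (auto simp: bij_betw_def inj_on_def)
  qed
  show ?thesis
  proof (rule ex1I[of _ m])
    show "m \<in> L \<and> (\<forall>x\<in>P. (x, l) \<in> I \<longleftrightarrow> (g x, m) \<in> I)" using m ex by auto
  next
    fix m' assume m': "m' \<in> L \<and> (\<forall>x\<in>P. (x, l) \<in> I \<longleftrightarrow> (g x, m') \<in> I)"
    then have "(g x, m') \<in> I" "(g y, m') \<in> I" using xy by auto
    then show "m' = m"
      using at_most_one_line[of "g x" "g y" m' m] ne gP xy m m' by blast
  qed
qed

lemma (in generalized_quadrangle) line_action:
  assumes "g \<in> automorphisms P L I" "l \<in> L"
  shows "line_action P L I g l \<in> L"
    and "\<And>x. x \<in> P \<Longrightarrow> (g x, line_action P L I g l) \<in> I \<longleftrightarrow> (x, l) \<in> I"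
  using theI'[OF ex1_image_line[OF assms]] assms(2) by (auto simp: line_action_def)

lemma (in generalized_quadrangle) line_action_eqI:
  assumes "g \<in> automorphisms P L I" "l \<in> L" "m \<in> L"
    and "\<And>x. x \<in> P \<Longrightarrow> (x, l) \<in> I \<longleftrightarrow> (g x, m) \<in> I"
  shows "line_action P L I g l = m"
  using the1_equality[OF ex1_image_line[OF assms(1,2)], of m] assms(2-4)
  by (auto simp: line_action_def)

lemma automorphisms_subgroup: "subgroup (automorphisms P L I) (BijGroup P)"
proof -
  interpret G: group "BijGroup P" by (rule group_BijGroup)
  have car: "carrier (BijGroup P) = Bij P" by (simp add: BijGroup_def)
  have mem: "g x \<in> P" if "g \<in> Bij P" "x \<in> P" for g x
    using that Bij_imp_funcset by blast
  show ?thesis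
  proof (rule G.subgroupI)
    show "automorphisms P L I \<subseteq> carrier (BijGroup P)" by (auto simp: automorphisms_def car)
    have "(\<lambda>x\<in>P. x) \<in> automorphisms P L I" by (simp add: automorphisms_def id_Bij)
    then show "automorphisms P L I \<noteq> {}" by auto
  next
    fix g assume g: "g \<in> automorphisms P L I"
    then have gB: "g \<in> Bij P" by (simp add: automorphisms_def)
    have inv: "inv\<^bsub>BijGroup P\<^esub> g = (\<lambda>x\<in>P. inv_into P g x)"
      using inv_BijGroup[OF gB] .
    have gi: "g (inv_into P g x) = x" "inv_into P g x \<in> P" if "x \<in> P" for x
      using gB that by (auto simp: Bij_def bij_betw_def f_inv_into_f inv_into_into)
    have "collinear L I x y \<longleftrightarrow> collinear L I (inv_into P g x) (inv_into P g y)"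
      if "x \<in> P" "y \<in> P" for x y
      using g gi[OF that(1)] gi[OF that(2)] by (auto simp: automorphisms_def)
    then show "inv\<^bsub>BijGroup P\<^esub> g \<in> automorphisms P L I"
      using restrict_inv_into_Bij[OF gB] by (simp add: inv automorphisms_def)
  next
    fix g h assume "g \<in> automorphisms P L I" "h \<in> automorphisms P L I"
    then show "g \<otimes>\<^bsub>BijGroup P\<^esub> h \<in> automorphisms P L I"
      by (auto simp: automorphisms_def BijGroup_def compose_Bij compose_eq mem)
  qed
qed

lemma group_aut_group: "group (aut_group P L I)"
  unfolding aut_group_def
  using subgroup.subgroup_is_group[OF automorphisms_subgroup group_BijGroup] .

lemma group_action_points: "group_action (aut_group P L I) P (\<lambda>g. g)"
proof -
  have "(\<lambda>g. g) \<in> hom (aut_group P L I) (BijGroup P)"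
    using subgroup.subset[OF automorphisms_subgroup, of P L I]
    by (auto simp: hom_def aut_group_def)
  then show ?thesis
    by (simp add: group_action_def group_hom_def group_hom_axioms_def
        group_aut_group group_BijGroup)
qed

lemma (in generalized_quadrangle) group_action_lines:
  "group_action (aut_group P L I) L (line_action P L I)"
proof -
  have bij: "line_action P L I g \<in> Bij L" if g: "g \<in> automorphisms P L I" for g
  proof -
    have inj: "inj_on (line_action P L I g) L"
    proof (rule inj_onI)
      fix l m assume "l \<in> L" "m \<in> L" "line_action P L I g l = line_action P L I g m"
      then show "l = m" using line_action(2)[OF g] by (metis line_eqI)
    qed
    moreover have "line_action P L I g ` L \<subseteq> L" using line_action(1)[OF g] by auto
    ultimately have "bij_betw (line_action P L I g) L L"
      using finite_lines by (simp add: bij_betw_def endo_inj_surj)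
    then show ?thesis by (simp add: Bij_def line_action_def)
  qed
  have mult: "line_action P L I (g \<otimes>\<^bsub>BijGroup P\<^esub> h) =
      line_action P L I g \<otimes>\<^bsub>BijGroup L\<^esub> line_action P L I h"
    if g: "g \<in> automorphisms P L I" and h: "h \<in> automorphisms P L I" for g h
  proof -
    have B: "g \<in> Bij P" "h \<in> Bij P" using g h by (auto simp: automorphisms_def)
    have hP: "h x \<in> P" if "x \<in> P" for x using B(2) that Bij_imp_funcset by blast
    have gh: "compose P g h \<in> automorphisms P L I"
      using subgroup.m_closed[OF automorphisms_subgroup g h] B by (simp add: BijGroup_def)
    have "line_action P L I (compose P g h) =
        compose L (line_action P L I g) (line_action P L I h)"
    proof (rule extensionalityI[of _ L])
      show "line_action P L I (compose P g h) \<in> extensional L" by (simp add: line_action_def)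
      show "compose L (line_action P L I g) (line_action P L I h) \<in> extensional L" by simp
      fix l assume l: "l \<in> L"
      show "line_action P L I (compose P g h) l =
          compose L (line_action P L I g) (line_action P L I h) l"
        using line_action[OF h l] line_action[OF g] hP
        by (intro line_action_eqI[OF gh l]) (auto simp: compose_eq l)
    qed
    then show ?thesis using B bij[OF g] bij[OF h] by (simp add: BijGroup_def)
  qed
  have "line_action P L I \<in> hom (aut_group P L I) (BijGroup L)"
    using bij mult by (auto simp: hom_def aut_group_def) (simp add: BijGroup_def)
  then show ?thesis
    by (simp add: group_action_def group_hom_def group_hom_axioms_def
        group_aut_group group_BijGroup)
qed

end

theory Submission
  imports Defs "HOL-Algebra.Multiplicative_Group" "HOL-Algebra.Sylow"
    "HOL-Number_Theory.Cong" "Jordan_Normal_Form.Schur_Decomposition"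
begin

text \<open>
  A quadrangle of order \<open>(4,12)\<close> has \<open>245 = 5 * 49\<close> points and \<open>637 = 13 * 49\<close> lines, so a group
  of automorphisms that is transitive on either has a subgroup \<open>S\<close> of order \<open>49\<close>. Such a group
  is abelian, and it cannot act on the quadrangle, for the following reasons.

  An automorphism \<open>g\<close> of order 7 that fixes a point fixes all points on each of its fixed lines (a
  line has only 5) and at least \<open>13 mod 7 = 6\<close> lines through each of its fixed points. That is
  so much that a moved point would be collinear with too many fixed points. Hence \<open>S\<close> acts freely
  on the points, with 5 orbits (\<open>automorphism_eq_id_of_large_prime_order\<close>).

  Let \<open>K\<close> be the matrix indexed by the points with entries \<open>16\<close> (equal points), \<open>-4\<close> (collinear
  points) and \<open>1\<close> (other pairs). It is 80 times the orthogonal projection onto the eigenspace of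
  the collinearity graph for the eigenvalue \<open>-13\<close>, so \<open>K\<^sup>2 = 80 K\<close> (\<open>eigenspace_kernel_square\<close>). As in
  Benson's theorem, the trace of \<open>g K / 80\<close> is a sum of roots of unity and a rational number,
  hence an integer (\<open>dvd_trace_of_scaled_idempotent_kernel\<close>). For \<open>g\<close> in \<open>S\<close> other than the
  identity this trace is \<open>49 m / 80\<close>, where \<open>m\<close> is a sum of five numbers \<open>1\<close> or \<open>-4\<close>, which forces
  it to vanish.

  Choosing a point in each orbit turns \<open>K\<close> into a \<open>5 \<times> 5\<close> hermitian matrix
  over the group ring \<open>\<int>[S]\<close>, whose square is 80 times itself and whose trace is, by the
  vanishing just found, 80 times the identity element. Such a matrix has rank one: its \<open>2 \<times>
  2\<close> minors vanish (\<open>hermitian_scaled_idempotent_rank_one\<close>). Summing coefficients in the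
  minors gives relations between integers that leave only one possibility: some orbit consists of pairwise
  non-collinear points. The diagonal entry of that orbit is \<open>15\<close> times the identity plus the sum
  of all group elements, so, modulo 3, the minors say that the entry \<open>f\<close> for this orbit and any
  other satisfies \<open>f f\<^sup>* = c\<close> for some multiple \<open>c\<close> of that sum. As the powers of 3 modulo 49
  include \<open>-1\<close>, the conjugate \<open>f\<^sup>*\<close> is a Frobenius power of \<open>f\<close> modulo 3, which makes all
  coefficients of \<open>f\<close> congruent modulo 3 (\<open>conv_star_cong_0_imp_cong_0\<close>). Being \<open>1\<close> or \<open>-4\<close>, they are
  equal, and this contradicts the integer relations.
\<close>

section \<open>Integrality of traces\<close>

lemma trace_mult_commute:
  fixes X Y :: "'a::comm_ring_1 mat"
  assumes X: "X \<in> carrier_mat n n" and Y: "Y \<in> carrier_mat n n"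
  shows "(\<Sum>i<n. (X * Y) $$ (i, i)) = (\<Sum>i<n. (Y * X) $$ (i, i))"
proof -
  have "(\<Sum>i<n. (X * Y) $$ (i, i)) = (\<Sum>i<n. \<Sum>j<n. X $$ (i, j) * Y $$ (j, i))"
    using X Y by (auto simp: scalar_prod_def atLeast0LessThan intro!: sum.cong)
  also have "\<dots> = (\<Sum>j<n. \<Sum>i<n. Y $$ (j, i) * X $$ (i, j))"
    by (subst sum.swap) (simp add: mult.commute)
  also have "\<dots> = (\<Sum>i<n. (Y * X) $$ (i, i))"
    using X Y by (auto simp: scalar_prod_def atLeast0LessThan intro!: sum.cong)
  finally show ?thesis .
qed

text \<open>
  By Schur's theorem the matrix is similar to a triangular one with the eigenvalues on the
  diagonal, and similar matrices have the same trace.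
\<close>

lemma trace_eq_sum_eigenvalues:
  fixes A :: "complex mat"
  assumes A: "A \<in> carrier_mat n n"
  obtains es where "(\<Sum>i<n. A $$ (i, i)) = sum_list es" "\<forall>e\<in>set es. eigenvalue A e"
proof -
  obtain es where es: "char_poly A = (\<Prod>e\<leftarrow>es. [:- e, 1:])"
    using char_poly_factorized[OF A] by blast
  obtain B U V where dec: "schur_decomposition A es = (B, U, V)"
    by (cases "schur_decomposition A es")
  have wit: "similar_mat_wit A B U V" and diag: "diag_mat B = es"
    using schur_decomposition[OF A es dec] by auto
  note w = similar_mat_witD2[OF A wit]
  have "(\<Sum>i<n. A $$ (i, i)) = (\<Sum>i<n. ((U * B) * V) $$ (i, i))" using w by simp
  also have "\<dots> = (\<Sum>i<n. (V * (U * B)) $$ (i, i))"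
    by (rule trace_mult_commute) (use w in auto)
  also have "V * (U * B) = B"
    using w(2) assoc_mult_mat[OF w(7,6,5)] left_mult_one_mat[OF w(5)] by simp
  also have "(\<Sum>i<n. B $$ (i, i)) = sum_list es"
    using w(5) by (simp flip: diag add: diag_mat_def interv_sum_list_conv_sum_set_nat atLeast0LessThan)
  finally have tr: "(\<Sum>i<n. A $$ (i, i)) = sum_list es" .
  have "eigenvalue A e" if "e \<in> set es" for e
    unfolding eigenvalue_root_char_poly[OF A] es poly_prod_list
    using that by (force simp: prod_list_zero_iff)
  then show thesis using tr that by blast
qed

text \<open>
  Let \<open>w\<close> be a primitive \<open>n\<close>-th root of unity. Multiplication by a power of \<open>w\<close> permutes the
  powers of \<open>w\<close>, so multiplication by the sum maps each of them to an integral combination of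
  them. The sum is thus an eigenvalue of an integer matrix, with the vector of the powers of \<open>w\<close> as
  eigenvector, and a root of the characteristic polynomial, which is monic. The hypothesis
  \<open>e ^ Suc n = e\<close> also admits \<open>0\<close>, an eigenvalue of the singular matrices to which this is applied.
\<close>

lemma sum_list_roots_of_unity_is_algebraic_int:
  fixes es :: "complex list"
  assumes n: "0 < n" and es: "\<forall>e\<in>set es. e ^ Suc n = e"
  shows "algebraic_int (sum_list es)"
proof -
  define w where "w = cis (2 * pi / real n)"
  have root: "\<exists>k<n. e = w ^ k" if "e ^ n = 1" for e
  proof -
    have "e \<in> (\<lambda>k. cis (2 * pi * real k / real n)) ` {..<n}"
      using bij_betw_roots_unity[OF n] that by (auto simp: bij_betw_def)
    then show ?thesis by (auto simp: w_def DeMoivre mult.commute)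
  qed
  have w1: "w ^ n = 1" using n by (simp add: w_def DeMoivre)
  have "\<exists>M :: nat \<Rightarrow> nat \<Rightarrow> int. \<forall>i<n. sum_list es * w ^ i = (\<Sum>j<n. of_int (M i j) * w ^ j)"
    using es
  proof (induction es)
    case Nil
    show ?case by (rule exI[of _ "\<lambda>_ _. 0"]) simp
  next
    case (Cons e es)
    then obtain M :: "nat \<Rightarrow> nat \<Rightarrow> int" where
      M: "\<forall>i<n. sum_list es * w ^ i = (\<Sum>j<n. of_int (M i j) * w ^ j)" by auto
    obtain N :: "nat \<Rightarrow> nat \<Rightarrow> int" where
      N: "\<forall>i<n. e * w ^ i = (\<Sum>j<n. of_int (N i j) * w ^ j)"
    proof (cases "e = 0")
      case True
      then show ?thesis using that[of "\<lambda>_ _. 0"] by simp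
    next
      case False
      then have "e ^ n = 1" using Cons.prems by simp
      then obtain k where k: "e = w ^ k" using root by blast
      have "e * w ^ i = (\<Sum>j<n. of_int (if j = (k + i) mod n then 1 else 0) * w ^ j)" for i
      proof -
        have "e * w ^ i = w ^ ((k + i) mod n + n * ((k + i) div n))"
          by (simp add: k flip: power_add)
        also have "\<dots> = w ^ ((k + i) mod n)" by (simp only: power_add power_mult w1) simp
        also have "\<dots> = (\<Sum>j<n. of_int (if j = (k + i) mod n then 1 else 0) * w ^ j)"
          using n by (simp add: if_distrib[of of_int] if_distrib[of "\<lambda>x. x * _"] sum.delta cong: if_cong)
        finally show ?thesis .
      qed
      then show ?thesis
        using that[of "\<lambda>i j. if j = (k + i) mod n then 1 else 0"] by blast
    qed
    show ?case
      by (rule exI[of _ "\<lambda>i j. M i j + N i j"])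
        (use M N in \<open>simp add: algebra_simps sum.distrib\<close>)
  qed
  then obtain M :: "nat \<Rightarrow> nat \<Rightarrow> int" where
    M: "\<And>i. i < n \<Longrightarrow> sum_list es * w ^ i = (\<Sum>j<n. of_int (M i j) * w ^ j)" by blast
  define A where "A = mat n n (\<lambda>(i, j). M i j)"
  have A: "A \<in> carrier_mat n n" by (simp add: A_def)
  let ?A = "map_mat complex_of_int A" and ?v = "vec n (\<lambda>i. w ^ i)"
  have cA: "?A \<in> carrier_mat n n" using A by simp
  have "?A *\<^sub>v ?v = sum_list es \<cdot>\<^sub>v ?v"
    by (rule eq_vecI) (auto simp: A_def scalar_prod_def M atLeast0LessThan)
  moreover have "?v $ 0 \<noteq> 0\<^sub>v n $ 0" using n by simp
  then have "?v \<noteq> 0\<^sub>v n" by metis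
  ultimately have "eigenvector ?A ?v (sum_list es)"
    by (simp add: eigenvector_def A_def)
  then have "poly (char_poly ?A) (sum_list es) = 0"
    using eigenvalue_root_char_poly[OF cA] by (auto simp: eigenvalue_def)
  moreover have "char_poly ?A = map_poly complex_of_int (char_poly A)"
    by (rule of_int_hom.char_poly_hom[OF A])
  moreover have "lead_coeff (char_poly A) = 1"
    using degree_monic_char_poly[OF A] by simp
  ultimately show ?thesis
    unfolding algebraic_int_altdef_ipoly by metis
qed

lemma int_multiple_dvd_of_algebraic_int:
  fixes c t :: int
  assumes "c \<noteq> 0" "algebraic_int (of_int t / of_int c :: complex)"
  shows "c dvd t"
proof -
  have "of_int t / of_int c \<in> (\<rat> :: complex set)" by simp
  then have "of_int t / of_int c \<in> (\<int> :: complex set)"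
    using rational_algebraic_int_is_int assms(2) by blast
  then obtain k where "of_int t / of_int c = (of_int k :: complex)" by (auto elim: Ints_cases)
  then have "(of_int t :: complex) = of_int (c * k)" using assms(1) by (simp add: field_simps)
  then show ?thesis by (metis dvd_triv_left of_int_eq_iff)
qed

text \<open>
  With \<open>K / c\<close> idempotent and \<open>g\<close> of finite order \<open>n\<close> commuting with it, the matrix
  \<open>B = g K / c\<close> satisfies \<open>B ^ (n + 1) = B\<close>. Its eigenvalues are therefore roots of unity or zero, and
  its trace, an algebraic integer that is rational, is an integer.
\<close>

lemma dvd_trace_of_scaled_idempotent_kernel:
  fixes K :: "'p \<Rightarrow> 'p \<Rightarrow> int"
  assumes fin: "finite P" and c: "c \<noteq> 0" and n: "0 < n"
    and gP: "\<And>x. x \<in> P \<Longrightarrow> g x \<in> P"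
    and inv: "\<And>x y. x \<in> P \<Longrightarrow> y \<in> P \<Longrightarrow> K (g x) (g y) = K x y"
    and per: "\<And>x. x \<in> P \<Longrightarrow> (g ^^ n) x = x"
    and sq: "\<And>x z. x \<in> P \<Longrightarrow> z \<in> P \<Longrightarrow> (\<Sum>y\<in>P. K x y * K y z) = c * K x z"
  shows "c dvd (\<Sum>x\<in>P. K (g x) x)"
proof -
  define N where "N = card P"
  obtain p where p: "bij_betw p {..<N} P"
    using ex_bij_betw_nat_finite[OF fin] by (auto simp: N_def atLeast0LessThan)
  have pP: "p i \<in> P" if "i < N" for i using p that by (auto simp: bij_betw_def)
  have gkP: "(g ^^ k) x \<in> P" if "x \<in> P" for k x using that gP by (induction k) auto
  have step: "(\<Sum>y\<in>P. K ((g ^^ k) x) y * K (g y) z) = c * K ((g ^^ Suc k) x) z"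
    if x: "x \<in> P" and z: "z \<in> P" for k x z
  proof -
    \<comment> \<open>The point that \<open>g\<close> maps to \<open>z\<close>: the inverse of \<open>g\<close> on \<open>P\<close> is \<open>g ^^ (n - 1)\<close>.\<close>
    let ?z = "(g ^^ (n - 1)) z"
    have zP: "?z \<in> P" using z gkP by blast
    have "g ?z = (g ^^ Suc (n - 1)) z" by simp
    then have gz: "g ?z = z" using per[OF z] n by simp
    have "(\<Sum>y\<in>P. K ((g ^^ k) x) y * K (g y) z) = (\<Sum>y\<in>P. K ((g ^^ k) x) y * K y ?z)"
      using inv[OF _ zP] gz by (intro sum.cong) auto
    also have "\<dots> = c * K ((g ^^ k) x) ?z" using sq gkP x zP by blast
    also have "K ((g ^^ k) x) ?z = K ((g ^^ Suc k) x) z"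
      using inv[OF gkP[OF x] zP] gz by simp
    finally show ?thesis .
  qed
  define B where "B = mat N N (\<lambda>(i, j). of_int (K (g (p i)) (p j)) / of_int c :: complex)"
  have B: "B \<in> carrier_mat N N" by (simp add: B_def)
  have pow: "B ^\<^sub>m Suc k = mat N N (\<lambda>(i, j). of_int (K ((g ^^ Suc k) (p i)) (p j)) / of_int c)" for k
  proof (induction k)
    case 0
    show ?case using B by (simp add: B_def)
  next
    case (Suc k)
    have "B ^\<^sub>m Suc (Suc k) = B ^\<^sub>m Suc k * B" by simp
    also have "\<dots> = mat N N (\<lambda>(i, j). of_int (K ((g ^^ Suc (Suc k)) (p i)) (p j)) / of_int c)"
    proof (rule eq_matI)
      fix i j assume "i < dim_row (mat N N (\<lambda>(i, j). of_int (K ((g ^^ Suc (Suc k)) (p i)) (p j)) / of_int c :: complex))"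
        "j < dim_col (mat N N (\<lambda>(i, j). of_int (K ((g ^^ Suc (Suc k)) (p i)) (p j)) / of_int c :: complex))"
      then have ij: "i < N" "j < N" by auto
      have "(B ^\<^sub>m Suc k * B) $$ (i, j) =
          (\<Sum>l<N. of_int (K ((g ^^ Suc k) (p i)) (p l) * K (g (p l)) (p j)) / (of_int c * of_int c))"
        unfolding Suc.IH using ij by (simp add: B_def scalar_prod_def atLeast0LessThan)
      also have "\<dots> = of_int (\<Sum>l<N. K ((g ^^ Suc k) (p i)) (p l) * K (g (p l)) (p j)) / (of_int c * of_int c)"
        by (simp add: sum_divide_distrib)
      also have "(\<Sum>l<N. K ((g ^^ Suc k) (p i)) (p l) * K (g (p l)) (p j)) =
          c * K ((g ^^ Suc (Suc k)) (p i)) (p j)"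
        using sum.reindex_bij_betw[OF p, of "\<lambda>y. K ((g ^^ Suc k) (p i)) y * K (g y) (p j)"]
          step[OF pP pP, of i j "Suc k"] ij by simp
      also have "of_int (c * K ((g ^^ Suc (Suc k)) (p i)) (p j)) / (of_int c * of_int c) =
          (of_int (K ((g ^^ Suc (Suc k)) (p i)) (p j)) / of_int c :: complex)"
        using c by simp
      finally show "(B ^\<^sub>m Suc k * B) $$ (i, j) = mat N N (\<lambda>(i, j). of_int (K ((g ^^ Suc (Suc k)) (p i)) (p j)) / of_int c) $$ (i, j)"
        using ij by simp
    qed (use B in \<open>auto simp: B_def\<close>)
    finally show ?case .
  qed
  have "B ^\<^sub>m Suc n = B"
    unfolding pow by (rule eq_matI) (auto simp: B_def per pP)
  obtain es where es: "(\<Sum>i<N. B $$ (i, i)) = sum_list es" "\<forall>e\<in>set es. eigenvalue B e"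
    using trace_eq_sum_eigenvalues[OF B] .
  have "e ^ Suc n = e" if e: "e \<in> set es" for e
  proof -
    obtain v where v: "eigenvector B v e" using es e by (auto simp: eigenvalue_def)
    have v': "v \<in> carrier_vec N" "v \<noteq> 0\<^sub>v N" "B *\<^sub>v v = e \<cdot>\<^sub>v v"
      using v B by (auto simp: eigenvector_def)
    have "e ^ Suc n \<cdot>\<^sub>v v = e \<cdot>\<^sub>v v"
      using eigenvector_pow[OF B v, of "Suc n"] \<open>B ^\<^sub>m Suc n = B\<close> v' by simp
    moreover obtain i where "i < N" "v $ i \<noteq> 0"
      using v' by (metis eq_vecI carrier_vecD index_zero_vec)
    ultimately show ?thesis
      using v'(1) by (metis carrier_vecD index_smult_vec(1) mult_right_cancel)
  qed
  then have "algebraic_int (sum_list es)"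
    using sum_list_roots_of_unity_is_algebraic_int[OF n] by blast
  moreover have "sum_list es = of_int (\<Sum>x\<in>P. K (g x) x) / of_int c"
    unfolding sum.reindex_bij_betw[OF p, of "\<lambda>x. K (g x) x", symmetric]
    by (simp flip: es(1) add: B_def sum_divide_distrib)
  ultimately show ?thesis
    using int_multiple_dvd_of_algebraic_int[OF c, of "\<Sum>x\<in>P. K (g x) x"] by simp
qed

section \<open>Fixed points of permutations of prime order\<close>

lemma funpow_prime_fixed:
  assumes p: "prime p" and per: "(r ^^ p) a = a" and d: "0 < d" "d < p" and fx: "(r ^^ d) a = a"
  shows "r a = a"
proof -
  have mult: "(r ^^ (m * q)) a = a" if "(r ^^ q) a = a" for m q
    using that by (induction m) (simp_all add: funpow_add)
  have "coprime d p"
    using p d by (metis coprime_commute nat_dvd_not_less prime_imp_coprime)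
  then obtain u where u: "[d * u = 1] (mod p)" using cong_solve_coprime_nat[of d p] by auto
  have "p > 1" using p by (rule prime_gt_1_nat)
  then have "(d * u) mod p = 1" using u by (simp add: cong_def)
  then obtain m where e: "u * d = Suc (m * p)"
    using div_mult_mod_eq[of "d * u" p] by (metis Suc_eq_plus1 mult.commute)
  have "r ((r ^^ (m * p)) a) = (r ^^ (u * d)) a" by (simp only: e funpow.simps comp_def)
  then show ?thesis using mult[OF fx] mult[OF per] by simp
qed

text \<open>
  The points that \<open>r\<close> moves fall into cycles of length \<open>p\<close>, and \<open>w\<close> is constant on each of them.
  The proof removes one cycle at a time.
\<close>

lemma sum_cong_sum_fixed_points:
  fixes w :: "'a \<Rightarrow> int"
  assumes p: "prime p" and fin: "finite A"
    and rA: "\<And>a. a \<in> A \<Longrightarrow> r a \<in> A" and per: "\<And>a. a \<in> A \<Longrightarrow> (r ^^ p) a = a"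
    and w: "\<And>a. a \<in> A \<Longrightarrow> w (r a) = w a"
  shows "[(\<Sum>a\<in>A. w a) = (\<Sum>a\<in>{a\<in>A. r a = a}. w a)] (mod int p)"
  using fin rA per w
proof (induction "card A" arbitrary: A rule: less_induct)
  case less
  show ?case
  proof (cases "\<forall>a\<in>A. r a = a")
    case True
    then have "{a\<in>A. r a = a} = A" by blast
    then show ?thesis by simp
  next
    case False
    then obtain a where a: "a \<in> A" "r a \<noteq> a" by blast
    have kA: "(r ^^ k) b \<in> A" if "b \<in> A" for k b using that less.prems(2) by (induction k) auto
    have rewind: "(r ^^ (p - i)) ((r ^^ (i + j)) b) = (r ^^ j) b" if "b \<in> A" "i \<le> p" for b i j
    proof -
      have "(r ^^ (p - i)) ((r ^^ (i + j)) b) = (r ^^ (j + p)) b"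
        using that by (simp flip: comp_apply[of "r ^^ _"] funpow_add add: add.commute)
      then show ?thesis using less.prems(3)[OF that(1)] by (simp add: funpow_add)
    qed
    let ?O = "(\<lambda>i. (r ^^ i) a) ` {..<p}"
    have nfix: "(r ^^ i) a \<noteq> (r ^^ j) a" if "i < j" "j < p" for i j
    proof
      assume e: "(r ^^ i) a = (r ^^ j) a"
      have "(r ^^ (j - i)) a = a"
        using rewind[OF a(1), of i 0] rewind[OF a(1), of i "j - i"] e that by simp
      then show False using funpow_prime_fixed[OF p less.prems(3)[OF a(1)], of "j - i"] that a by (simp add: less_imp_diff_less)
    qed
    have inj: "inj_on (\<lambda>i. (r ^^ i) a) {..<p}"
      by (rule inj_onI) (metis lessThan_iff nat_neq_iff nfix)
    have OA: "?O \<subseteq> A" using kA a by blast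
    have nO: "r b \<noteq> b" if b: "b \<in> ?O" for b
    proof
      assume e: "r b = b"
      obtain i where i: "i < p" "b = (r ^^ i) a" using b by blast
      have "(r ^^ (p - i)) ((r ^^ (i + 1)) a) = (r ^^ (p - i)) ((r ^^ (i + 0)) a)"
        using e i by simp
      then show False using rewind[OF a(1), of i 1] rewind[OF a(1), of i 0] i a by simp
    qed
    have w_orb: "w b = w a" if "b \<in> ?O" for b
    proof -
      have "w ((r ^^ i) a) = w a" for i
        by (induction i) (use less.prems(4) kA a in auto)
      then show ?thesis using that by blast
    qed
    have rest: "r b \<in> A - ?O" if b: "b \<in> A - ?O" for b
    proof -
      have "r b \<notin> ?O"
      proof
        assume "r b \<in> ?O"
        then obtain i where i: "i < p" "r b = (r ^^ i) a" by blast
        have p1: "p > 0" using p prime_gt_0_nat by blast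
        have "b = (r ^^ (p - 1)) (r b)"
          using less.prems(3)[of b] b p1 by (metis DiffD1 Suc_diff_1 comp_apply funpow_Suc_right)
        also have "\<dots> = (r ^^ ((p - 1) + i)) a" by (simp add: i funpow_add)
        also have "\<dots> = (r ^^ (((p - 1) + i) mod p)) a"
          using funpow_mod_eq[OF less.prems(3)[OF a(1)]] by metis
        finally have "b \<in> ?O" using p1 by auto
        then show False using b by blast
      qed
      then show ?thesis using less.prems(2) b by blast
    qed
    have "a \<in> ?O" using prime_gt_0_nat[OF p] by (intro image_eqI[of _ _ 0]) auto
    then have smaller: "card (A - ?O) < card A"
      using a less.prems(1) by (intro psubset_card_mono) auto
    have IH: "[(\<Sum>a\<in>A - ?O. w a) = (\<Sum>a\<in>{a\<in>A - ?O. r a = a}. w a)] (mod int p)"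
      using less.prems rest by (intro less.hyps[OF smaller]) auto
    have fix_rest: "{a\<in>A - ?O. r a = a} = {a\<in>A. r a = a}" using nO by blast
    have total: "(\<Sum>a\<in>A. w a) = (\<Sum>a\<in>A - ?O. w a) + int p * w a"
    proof -
      have "(\<Sum>a\<in>?O. w a) = (\<Sum>b\<in>?O. w a)" by (rule sum.cong[OF refl]) (rule w_orb)
      also have "\<dots> = int p * w a" using inj by (simp add: card_image)
      finally show ?thesis using sum.subset_diff[OF OA less.prems(1), of w] by simp
    qed
    have "[(\<Sum>a\<in>A. w a) = (\<Sum>a\<in>A - ?O. w a) + 0] (mod int p)"
      unfolding total by (intro cong_add cong_refl) (simp add: cong_0_iff)
    then show ?thesis using cong_trans[OF _ IH] unfolding fix_rest by simp
  qed
qed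

lemma prime_dvd_card_moved_points:
  assumes p: "prime p" and fin: "finite A"
    and "\<And>a. a \<in> A \<Longrightarrow> r a \<in> A" "\<And>a. a \<in> A \<Longrightarrow> (r ^^ p) a = a"
  shows "p dvd card {a\<in>A. r a \<noteq> a}"
proof -
  let ?w = "\<lambda>_. 1 :: int"
  have "[int (card A) = int (card {a\<in>A. r a = a})] (mod int p)"
    using sum_cong_sum_fixed_points[OF p fin assms(3,4), of "?w"] by simp
  moreover have "card A = card {a\<in>A. r a \<noteq> a} + card {a\<in>A. r a = a}"
    using fin by (subst card_Un_disjoint[symmetric]) (auto intro: arg_cong[of _ _ card])
  ultimately have "[int (card {a\<in>A. r a \<noteq> a}) + int (card {a\<in>A. r a = a}) = 0 + int (card {a\<in>A. r a = a})] (mod int p)"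
    by simp
  then have "[int (card {a\<in>A. r a \<noteq> a}) = 0] (mod int p)"
    unfolding cong_add_rcancel by simp
  then show ?thesis by (simp add: cong_0_iff)
qed

section \<open>Convolution on a finite group\<close>

text \<open>
  The product of the integral group ring, whose elements are coefficient functions. Setting the
  product to \<open>0\<close> outside the carrier makes the ring laws hold as equations between functions.
\<close>

definition (in group) conv :: "('a \<Rightarrow> int) \<Rightarrow> ('a \<Rightarrow> int) \<Rightarrow> 'a \<Rightarrow> int" (infixl "\<star>" 70)
  where "a \<star> b = (\<lambda>g. if g \<in> carrier G then \<Sum>h\<in>carrier G. a h * b (inv h \<otimes> g) else 0)"

lemma (in group) conv_apply:
  "g \<in> carrier G \<Longrightarrow> (a \<star> b) g = (\<Sum>h\<in>carrier G. a h * b (inv h \<otimes> g))"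
  by (simp add: conv_def)

lemma (in group) conv_cong:
  assumes "\<And>g. g \<in> carrier G \<Longrightarrow> a g = a' g" "\<And>g. g \<in> carrier G \<Longrightarrow> b g = b' g"
  shows "a \<star> b = a' \<star> b'"
  using assms by (auto simp: conv_def intro!: sum.cong)

lemma (in comm_group) conv_commute: "a \<star> b = b \<star> a"
proof
  fix g
  show "(a \<star> b) g = (b \<star> a) g"
  proof (cases "g \<in> carrier G")
    case True
    have inv_inv: "inv (inv h \<otimes> g) \<otimes> g = h" if "h \<in> carrier G" for h
      using that True by (simp add: inv_mult m_assoc)
    show ?thesis unfolding conv_apply[OF True]
      by (rule sum.reindex_bij_witness[of _ "\<lambda>h. inv h \<otimes> g" "\<lambda>h. inv h \<otimes> g"])
        (use True inv_inv in auto)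
  qed (simp add: conv_def)
qed

lemma (in group) conv_assoc: "(a \<star> b) \<star> c = a \<star> (b \<star> c)"
proof
  fix g
  show "((a \<star> b) \<star> c) g = (a \<star> (b \<star> c)) g"
  proof (cases "g \<in> carrier G")
    case True
    let ?S = "carrier G"
    have "((a \<star> b) \<star> c) g = (\<Sum>h\<in>?S. \<Sum>k\<in>?S. a k * b (inv k \<otimes> h) * c (inv h \<otimes> g))"
      using True by (simp add: conv_apply sum_distrib_right)
    also have "\<dots> = (\<Sum>k\<in>?S. \<Sum>h\<in>?S. a k * b (inv k \<otimes> h) * c (inv h \<otimes> g))"
      by (rule sum.swap)
    also have "\<dots> = (\<Sum>k\<in>?S. \<Sum>m\<in>?S. a k * b m * c (inv m \<otimes> (inv k \<otimes> g)))"
    proof (rule sum.cong[OF refl])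
      fix k assume k: "k \<in> ?S"
      have inv_inv: "inv (inv k \<otimes> h) \<otimes> (inv k \<otimes> g) = inv h \<otimes> g" if "h \<in> ?S" for h
        using that k True by (simp add: inv_mult_group m_assoc r_cancel_one flip: m_assoc[of k])
      show "(\<Sum>h\<in>?S. a k * b (inv k \<otimes> h) * c (inv h \<otimes> g)) =
          (\<Sum>m\<in>?S. a k * b m * c (inv m \<otimes> (inv k \<otimes> g)))"
        by (rule sum.reindex_bij_witness[of _ "\<lambda>m. k \<otimes> m" "\<lambda>h. inv k \<otimes> h"])
          (use True k inv_inv in \<open>auto simp flip: m_assoc\<close>)
    qed
    also have "\<dots> = (a \<star> (b \<star> c)) g"
      using True by (simp add: conv_apply sum_distrib_left mult.assoc)
    finally show ?thesis .
  qed (simp add: conv_def)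
qed

lemma (in comm_group) conv_left_commute: "a \<star> (b \<star> c) = b \<star> (a \<star> c)"
  by (metis conv_assoc conv_commute)

lemmas (in comm_group) conv_ac = conv_assoc conv_commute conv_left_commute

lemma (in group) conv_sum_sum:
  assumes "g \<in> carrier G"
  shows "(\<Sum>x\<in>X. \<Sum>y\<in>Y. (a x \<star> b y) g) = ((\<lambda>g. \<Sum>x\<in>X. a x g) \<star> (\<lambda>g. \<Sum>y\<in>Y. b y g)) g"
proof -
  have "(\<Sum>x\<in>X. \<Sum>y\<in>Y. (a x \<star> b y) g) =
      (\<Sum>x\<in>X. \<Sum>h\<in>carrier G. \<Sum>y\<in>Y. a x h * b y (inv h \<otimes> g))"
    unfolding conv_apply[OF assms] by (subst (2) sum.swap) (rule refl)
  also have "\<dots> = (\<Sum>h\<in>carrier G. \<Sum>x\<in>X. \<Sum>y\<in>Y. a x h * b y (inv h \<otimes> g))"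
    by (rule sum.swap)
  also have "\<dots> = ((\<lambda>g. \<Sum>x\<in>X. a x g) \<star> (\<lambda>g. \<Sum>y\<in>Y. b y g)) g"
    by (simp add: conv_apply[OF assms] sum_product)
  finally show ?thesis .
qed

lemma (in group) conv_scale:
  "((\<lambda>g. c * a g) \<star> (\<lambda>g. d * b g)) g = c * d * (a \<star> b) g"
  by (simp add: conv_def sum_distrib_left mult_ac)

text \<open>
  This turns sums of squares of coefficients into the coefficient at \<open>\<one>\<close> of a product, where the
  ring laws can be used.
\<close>

lemma (in group) inner_product_eq_conv:
  assumes "\<And>g. g \<in> carrier G \<Longrightarrow> b' g = b (inv g)"
  shows "(\<Sum>g\<in>carrier G. a g * b g) = (a \<star> b') \<one>"
  by (simp add: conv_apply assms)

lemma (in comm_group) conv_inv: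
  assumes "\<And>g. g \<in> carrier G \<Longrightarrow> a' g = a (inv g)" "\<And>g. g \<in> carrier G \<Longrightarrow> b' g = b (inv g)"
    and g: "g \<in> carrier G"
  shows "(a' \<star> b') g = (a \<star> b) (inv g)"
proof -
  have "(\<Sum>h\<in>carrier G. a' h * b' (inv h \<otimes> g)) = (\<Sum>h\<in>carrier G. a h * b (inv h \<otimes> inv g))"
    by (rule sum.reindex_bij_witness[of _ "\<lambda>h. inv h" "\<lambda>h. inv h"])
      (use g assms in \<open>auto simp: inv_mult\<close>)
  then show ?thesis using g by (simp add: conv_apply)
qed

lemma (in group) sum_conv:
  "(\<Sum>g\<in>carrier G. (a \<star> b) g) = (\<Sum>g\<in>carrier G. a g) * (\<Sum>g\<in>carrier G. b g)"
proof -
  let ?S = "carrier G"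
  have "(\<Sum>g\<in>?S. (a \<star> b) g) = (\<Sum>g\<in>?S. \<Sum>h\<in>?S. a h * b (inv h \<otimes> g))"
    by (simp add: conv_apply)
  also have "\<dots> = (\<Sum>h\<in>?S. \<Sum>g\<in>?S. a h * b (inv h \<otimes> g))" by (rule sum.swap)
  also have "\<dots> = (\<Sum>h\<in>?S. \<Sum>g\<in>?S. a h * b g)"
  proof (rule sum.cong[OF refl])
    fix h assume h: "h \<in> ?S"
    show "(\<Sum>g\<in>?S. a h * b (inv h \<otimes> g)) = (\<Sum>g\<in>?S. a h * b g)"
      by (rule sum.reindex_bij_witness[of _ "\<lambda>g. h \<otimes> g" "\<lambda>g. inv h \<otimes> g"])
        (use h in \<open>auto simp flip: m_assoc\<close>)
  qed
  finally show ?thesis by (simp add: sum_product)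
qed

text \<open>
  Under each character of the group, \<open>k\<close> becomes \<open>c\<close> times an orthogonal projection of trace 1, that
  is, of rank one, and so its minors vanish. The proof avoids characters: the squares of all
  coefficients of all \<open>2 \<times> 2\<close> minors sum to \<open>c\<^sup>4 - 2 * c\<^sup>4 + c\<^sup>4 = 0\<close>. Here each of the three
  terms is the coefficient at \<open>\<one>\<close> of a fourfold product, summed over all indices, which the
  quadratic relation and the trace evaluate.
\<close>

theorem (in comm_group) hermitian_scaled_idempotent_rank_one:
  fixes k :: "'x \<Rightarrow> 'x \<Rightarrow> 'a \<Rightarrow> int"
  assumes fin: "finite (carrier G)" and finX: "finite X"
    and herm: "\<And>x y g. x \<in> X \<Longrightarrow> y \<in> X \<Longrightarrow> g \<in> carrier G \<Longrightarrow> k x y (inv g) = k y x g"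
    and sq: "\<And>x z g. x \<in> X \<Longrightarrow> z \<in> X \<Longrightarrow> g \<in> carrier G \<Longrightarrow>
        (\<Sum>y\<in>X. (k x y \<star> k y z) g) = c * k x z g"
    and tr: "\<And>g. g \<in> carrier G \<Longrightarrow> (\<Sum>x\<in>X. k x x g) = (if g = \<one> then c else 0)"
    and xyzw: "x \<in> X" "y \<in> X" "z \<in> X" "w \<in> X"
  shows "k x y \<star> k z w = k x w \<star> k z y"
proof -
  let ?S = "carrier G"
  let ?D = "\<lambda>x y z w g. (k x y \<star> k z w) g - (k x w \<star> k z y) g"
  define N where "N x y z w = ((k x y \<star> k y x) \<star> (k z w \<star> k w z)) \<one>" for x y z w
  define C where "C x y z w = ((k x y \<star> k y z) \<star> (k z w \<star> k w x)) \<one>" for x y z w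
  have expand: "(\<Sum>g\<in>?S. (?D x y z w g)\<^sup>2) = N x y z w - 2 * C x y z w + N x w z y"
    if "x \<in> X" "y \<in> X" "z \<in> X" "w \<in> X" for x y z w
  proof -
    have star: "(k y x \<star> k w z) g = (k x y \<star> k z w) (inv g)"
      if "x \<in> X" "y \<in> X" "z \<in> X" "w \<in> X" "g \<in> ?S" for x y z w g
      using that by (intro conv_inv) (auto simp: herm)
    have ip: "(\<Sum>g\<in>?S. (k x y \<star> k z w) g * (k x' y' \<star> k z' w') g) =
        ((k x y \<star> k z w) \<star> (k y' x' \<star> k w' z')) \<one>"
      if "x' \<in> X" "y' \<in> X" "z' \<in> X" "w' \<in> X" for x' y' z' w' x y z w
      using that by (intro inner_product_eq_conv star)
    have "(\<Sum>g\<in>?S. (?D x y z w g)\<^sup>2) =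
        (\<Sum>g\<in>?S. (k x y \<star> k z w) g * (k x y \<star> k z w) g)
        - 2 * (\<Sum>g\<in>?S. (k x y \<star> k z w) g * (k x w \<star> k z y) g)
        + (\<Sum>g\<in>?S. (k x w \<star> k z y) g * (k x w \<star> k z y) g)"
      by (simp add: power2_eq_square algebra_simps sum.distrib sum_subtractf sum_distrib_left)
    then show ?thesis using that by (simp add: ip N_def C_def conv_ac)
  qed
  have sumN: "(\<Sum>x\<in>X. \<Sum>y\<in>X. \<Sum>z\<in>X. \<Sum>w\<in>X. N x y z w) = c ^ 4"
  proof -
    have "(\<Sum>x\<in>X. \<Sum>y\<in>X. \<Sum>z\<in>X. \<Sum>w\<in>X. N x y z w) =
        (\<Sum>x\<in>X. \<Sum>z\<in>X. \<Sum>y\<in>X. \<Sum>w\<in>X. N x y z w)"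
      by (intro sum.cong[OF refl] sum.swap)
    also have "\<dots> = (\<Sum>x\<in>X. \<Sum>z\<in>X. ((\<lambda>g. c * k x x g) \<star> (\<lambda>g. c * k z z g)) \<one>)"
      unfolding N_def conv_sum_sum[OF one_closed]
      by (intro sum.cong[OF refl] fun_cong[OF conv_cong] sq)
    also have "\<dots> = ((\<lambda>g. \<Sum>x\<in>X. c * k x x g) \<star> (\<lambda>g. \<Sum>x\<in>X. c * k x x g)) \<one>"
      by (rule conv_sum_sum[OF one_closed])
    also have "\<dots> = ((\<lambda>g. c * (if g = \<one> then c else 0)) \<star> (\<lambda>g. c * (if g = \<one> then c else 0))) \<one>"
      by (intro fun_cong[OF conv_cong]) (simp_all add: tr flip: sum_distrib_left)
    also have "\<dots> = (\<Sum>h\<in>?S. if h = \<one> then c ^ 4 else 0)"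
      unfolding conv_apply[OF one_closed]
      by (rule sum.cong) (auto simp: power4_eq_xxxx)
    also have "\<dots> = c ^ 4" using fin by simp
    finally show ?thesis .
  qed
  have sumC: "(\<Sum>x\<in>X. \<Sum>y\<in>X. \<Sum>z\<in>X. \<Sum>w\<in>X. C x y z w) = c ^ 4"
  proof -
    have "(\<Sum>x\<in>X. \<Sum>y\<in>X. \<Sum>z\<in>X. \<Sum>w\<in>X. C x y z w) =
        (\<Sum>x\<in>X. \<Sum>z\<in>X. \<Sum>y\<in>X. \<Sum>w\<in>X. C x y z w)"
      by (intro sum.cong[OF refl] sum.swap)
    also have "\<dots> = (\<Sum>x\<in>X. \<Sum>z\<in>X. ((\<lambda>g. c * k x z g) \<star> (\<lambda>g. c * k z x g)) \<one>)"
      unfolding C_def conv_sum_sum[OF one_closed]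
      by (intro sum.cong[OF refl] fun_cong[OF conv_cong] sq)
    also have "\<dots> = (\<Sum>x\<in>X. c * c * (c * k x x \<one>))"
      by (rule sum.cong[OF refl]) (simp only: conv_scale sum_distrib_left[symmetric] sq[OF _ _ one_closed])
    also have "\<dots> = c * c * (c * (\<Sum>x\<in>X. k x x \<one>))" by (simp only: sum_distrib_left)
    also have "\<dots> = c ^ 4" by (simp add: tr power4_eq_xxxx)
    finally show ?thesis .
  qed
  have "(\<Sum>x\<in>X. \<Sum>y\<in>X. \<Sum>z\<in>X. \<Sum>w\<in>X. \<Sum>g\<in>?S. (?D x y z w g)\<^sup>2) =
      (\<Sum>x\<in>X. \<Sum>y\<in>X. \<Sum>z\<in>X. \<Sum>w\<in>X. N x y z w) - 2 * (\<Sum>x\<in>X. \<Sum>y\<in>X. \<Sum>z\<in>X. \<Sum>w\<in>X. C x y z w)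
      + (\<Sum>x\<in>X. \<Sum>y\<in>X. \<Sum>z\<in>X. \<Sum>w\<in>X. N x w z y)"
    by (simp add: expand sum.distrib sum_subtractf sum_distrib_left cong: sum.cong)
  also have "(\<Sum>x\<in>X. \<Sum>y\<in>X. \<Sum>z\<in>X. \<Sum>w\<in>X. N x w z y) = c ^ 4"
  proof -
    have "(\<Sum>y\<in>X. \<Sum>z\<in>X. \<Sum>w\<in>X. N x w z y) = (\<Sum>w\<in>X. \<Sum>z\<in>X. \<Sum>y\<in>X. N x w z y)" for x
    proof -
      have "(\<Sum>y\<in>X. \<Sum>z\<in>X. \<Sum>w\<in>X. N x w z y) = (\<Sum>z\<in>X. \<Sum>y\<in>X. \<Sum>w\<in>X. N x w z y)"
        by (rule sum.swap)
      also have "\<dots> = (\<Sum>z\<in>X. \<Sum>w\<in>X. \<Sum>y\<in>X. N x w z y)" by (intro sum.cong[OF refl] sum.swap)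
      also have "\<dots> = (\<Sum>w\<in>X. \<Sum>z\<in>X. \<Sum>y\<in>X. N x w z y)" by (rule sum.swap)
      finally show ?thesis .
    qed
    then show ?thesis using sumN by simp
  qed
  finally have zero: "(\<Sum>x\<in>X. \<Sum>y\<in>X. \<Sum>z\<in>X. \<Sum>w\<in>X. \<Sum>g\<in>?S. (?D x y z w g)\<^sup>2) = 0"
    using sumN sumC by simp
  have "?D x y z w g = 0" if "g \<in> ?S" for g
    using zero xyzw that finX fin by (simp add: sum_nonneg_eq_0_iff sum_nonneg)
  then show ?thesis by (auto simp: conv_def fun_eq_iff)
qed

section \<open>Reduction of convolution modulo three\<close>

lemma (in group) pow_eq_inv:
  assumes "Coset.order G dvd n + 1" and h: "h \<in> carrier G"
  shows "h [^] (n :: nat) = inv h"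
proof -
  obtain q where q: "n + 1 = Coset.order G * q" using assms(1) by (auto elim: dvdE)
  have "h [^] n \<otimes> h = h [^] (n + 1)" by simp
  also have "\<dots> = \<one>" unfolding q using h by (simp add: pow_order_eq_1 flip: nat_pow_pow)
  finally show ?thesis using h by (metis inv_equality nat_pow_closed)
qed

text \<open>
  The Frobenius map of the group ring modulo 3: cubing an element modulo 3 replaces each group
  element by its cube. In the expansion of \<open>f \<star> (f \<star> f)\<close> the cyclic rotation of the three factors
  leaves fixed only the terms with equal factors. That \<open>-1\<close> is a power of 3 modulo the order of the
  group makes cubing injective on the group, so only one such term contributes to a given
  coefficient.
\<close>

lemma (in comm_group) conv_cube_cong:
  assumes fin: "finite (carrier G)" and n: "Coset.order G dvd 3 ^ Suc m + 1" and h: "h \<in> carrier G"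
  shows "[(f \<star> (f \<star> f)) (h [^] (3::nat)) = f h] (mod 3)"
proof -
  let ?S = "carrier G" and ?g = "h [^] (3::nat)"
  have g: "?g \<in> ?S" using h by simp
  have cube_inj: "a = h" if a: "a \<in> ?S" and e: "a [^] (3::nat) = ?g" for a
  proof -
    note pow = pow_eq_inv[OF n]
    have "inv a = inv h"
      using a h e pow[of a] pow[of h] by (simp flip: nat_pow_pow)
    then show ?thesis using a h by (metis inv_inv)
  qed
  let ?c = "\<lambda>(a, b). inv b \<otimes> (inv a \<otimes> ?g)"
  \<comment> \<open>A pair \<open>(a, b)\<close> stands for the triple \<open>(a, b, c)\<close> with product \<open>?g\<close>, which \<open>?r\<close> rotates.\<close>
  let ?r = "\<lambda>(a, b). (b, inv b \<otimes> (inv a \<otimes> ?g))"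
  let ?w = "\<lambda>(a, b). f a * (f b * f (inv b \<otimes> (inv a \<otimes> ?g)))"
  have cancel: "b \<otimes> (inv b \<otimes> x) = x" if "b \<in> ?S" "x \<in> ?S" for b x
    using that by (simp flip: m_assoc)
  have cancel': "inv b \<otimes> (b \<otimes> x) = x" if "b \<in> ?S" "x \<in> ?S" for b x
    using that by (simp flip: m_assoc)
  have cyc: "inv (inv b \<otimes> (inv a \<otimes> ?g)) \<otimes> (inv b \<otimes> ?g) = a" if "a \<in> ?S" "b \<in> ?S" for a b
  proof -
    have "inv (inv b \<otimes> (inv a \<otimes> ?g)) \<otimes> (inv b \<otimes> ?g) = (inv ?g \<otimes> a \<otimes> b) \<otimes> (inv b \<otimes> ?g)"
      using that g by (simp add: inv_mult_group m_assoc)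
    also have "\<dots> = inv ?g \<otimes> a \<otimes> ?g" using that g by (simp add: m_assoc cancel)
    also have "\<dots> = a" using that g by (metis inv_closed inv_solve_left m_assoc m_closed m_comm)
    finally show ?thesis .
  qed
  have r2: "?r (?r (a, b)) = (inv b \<otimes> (inv a \<otimes> ?g), a)" if "a \<in> ?S" "b \<in> ?S" for a b
    using that cyc by simp
  have r3: "?r (inv b \<otimes> (inv a \<otimes> ?g), a) = (a, b)" if "a \<in> ?S" "b \<in> ?S" for a b
  proof -
    have "inv a \<otimes> (inv (inv b \<otimes> (inv a \<otimes> ?g)) \<otimes> ?g) = b"
    proof -
      have "inv a \<otimes> (inv (inv b \<otimes> (inv a \<otimes> ?g)) \<otimes> ?g) = inv a \<otimes> ((inv ?g \<otimes> (a \<otimes> b)) \<otimes> ?g)"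
        using that g by (simp add: inv_mult_group m_assoc)
      also have "(inv ?g \<otimes> (a \<otimes> b)) \<otimes> ?g = a \<otimes> b"
        using that g by (metis inv_closed inv_solve_left m_assoc m_closed m_comm)
      finally show ?thesis using that by (simp flip: m_assoc)
    qed
    then show ?thesis by simp
  qed
  have "(f \<star> (f \<star> f)) ?g = (\<Sum>a\<in>?S. \<Sum>b\<in>?S. ?w (a, b))"
    using g by (simp add: conv_apply sum_distrib_left)
  also have "\<dots> = (\<Sum>ab\<in>?S \<times> ?S. ?w ab)" by (simp add: sum.cartesian_product)
  finally have 1: "(f \<star> (f \<star> f)) ?g = (\<Sum>ab\<in>?S \<times> ?S. ?w ab)" .
  have "[(\<Sum>ab\<in>?S \<times> ?S. ?w ab) = (\<Sum>ab\<in>{ab\<in>?S \<times> ?S. ?r ab = ab}. ?w ab)] (mod int 3)"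
  proof (rule sum_cong_sum_fixed_points)
    fix ab assume ab: "ab \<in> ?S \<times> ?S"
    then obtain a b where s: "ab = (a, b)" "a \<in> ?S" "b \<in> ?S" by blast
    show "?r ab \<in> ?S \<times> ?S" using s g by simp
    show "(?r ^^ 3) ab = ab" using r2[OF s(2,3)] r3[OF s(2,3)] by (simp add: s numeral_3_eq_3)
    show "?w (?r ab) = ?w ab" using cyc s by simp
  qed (use fin in auto)
  moreover have "{ab\<in>?S \<times> ?S. ?r ab = ab} = {(h, h)}"
  proof -
    have "inv h \<otimes> (inv h \<otimes> ?g) = h"
      using h by (simp add: numeral_3_eq_3 m_assoc inv_solve_left')
    moreover have "a = h" if "a \<in> ?S" "inv a \<otimes> (inv a \<otimes> ?g) = a" for a
    proof (rule cube_inj[OF that(1)])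
      have "?g = a \<otimes> (a \<otimes> a)" using that g by (metis inv_closed inv_solve_left m_closed)
      then show "a [^] (3::nat) = ?g" using that by (simp add: numeral_3_eq_3 m_assoc)
    qed
    ultimately show ?thesis using h by auto
  qed
  moreover have "?w (h, h) = f h ^ 3"
    using h by (simp add: numeral_3_eq_3 m_assoc cancel')
  moreover have "[f h ^ 3 = f h] (mod 3)"
  proof -
    have "f h mod 3 = 0 \<or> f h mod 3 = 1 \<or> f h mod 3 = 2" by presburger
    moreover have "f h ^ 3 mod 3 = (f h mod 3) ^ 3 mod 3" by (simp add: power_mod)
    ultimately show ?thesis by (auto simp: cong_def)
  qed
  ultimately show ?thesis unfolding 1 by (simp add: cong_trans)
qed


lemma (in group) conv_mod_cong:
  assumes "\<And>h. h \<in> carrier G \<Longrightarrow> [b h = b' h] (mod m)" and g: "g \<in> carrier G"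
  shows "[(a \<star> b) g = (a \<star> b') g] (mod m)"
  unfolding conv_apply[OF g] using assms by (intro cong_sum cong_mult cong_refl) simp

text \<open>
  Modulo 3, the iterated cubes \<open>u k\<close> of \<open>f\<close> are \<open>f\<close> with its argument raised to powers, and
  since \<open>3 ^ Suc m\<close> acts as inversion, \<open>u (Suc m)\<close> is the conjugate \<open>f'\<close> of \<open>f\<close>. As \<open>u (Suc m)\<close>
  is also a multiple of \<open>f\<close>, its cube is a multiple of \<open>f \<star> f'\<close> and vanishes; but that cube is again a
  rearrangement of \<open>f\<close>.
\<close>

lemma (in comm_group) conv_star_cong_0_imp_cong_0:
  assumes fin: "finite (carrier G)" and n: "Coset.order G dvd 3 ^ Suc m + 1"
    and star: "\<And>g. g \<in> carrier G \<Longrightarrow> f' g = f (inv g)"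
    and zero: "\<And>g. g \<in> carrier G \<Longrightarrow> [(f \<star> f') g = 0] (mod 3)"
    and g: "g \<in> carrier G"
  shows "[f g = 0] (mod 3)"
proof -
  let ?S = "carrier G"
  define u where "u = rec_nat f (\<lambda>_ v. v \<star> (v \<star> v))"
  have u0: "u 0 = f" and uS: "u (Suc k) = u k \<star> (u k \<star> u k)" for k by (simp_all add: u_def)
  have frob: "[u k (h [^] (3 ^ k :: nat)) = f h] (mod 3)" if h: "h \<in> ?S" for k h
  proof (induction k)
    case 0
    show ?case using h by (simp add: u0)
  next
    case (Suc k)
    have "h [^] (3 ^ Suc k :: nat) = (h [^] (3 ^ k :: nat)) [^] (3 :: nat)"
      using h by (simp add: nat_pow_pow mult.commute)
    then show ?case
      using conv_cube_cong[OF fin n, of "h [^] (3 ^ k :: nat)" "u k"] Suc.IH h uS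
      by (metis cong_trans nat_pow_closed)
  qed
  note inv_pow = pow_eq_inv[OF n]
  let ?v = "u (Suc m)"
  have v_star: "[?v h = f' h] (mod 3)" if h: "h \<in> ?S" for h
    using frob[of "inv h" "Suc m"] inv_pow[of "inv h"] star h by simp
  have "\<exists>w. u (Suc k) = f \<star> w" for k
  proof (induction k)
    case 0
    show ?case using uS[of 0] by (auto simp: u0)
  next
    case (Suc k)
    then obtain w where w: "u (Suc k) = f \<star> w" by blast
    have "u (Suc (Suc k)) = f \<star> (w \<star> (u (Suc k) \<star> u (Suc k)))"
      by (subst uS) (simp only: w conv_assoc)
    then show ?case by blast
  qed
  then obtain w where w: "?v = f \<star> w" by blast
  have "u (Suc (Suc m)) = (?v \<star> w) \<star> (f \<star> ?v)"
    by (subst uS) (simp add: w conv_ac)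
  moreover have "[((?v \<star> w) \<star> (f \<star> ?v)) h = 0] (mod 3)" if h: "h \<in> ?S" for h
  proof -
    have "[(f \<star> ?v) k = 0] (mod 3)" if "k \<in> ?S" for k
      using conv_mod_cong[of ?v f' 3 k f] v_star zero that cong_trans by blast
    then have "[((?v \<star> w) \<star> (f \<star> ?v)) h = ((?v \<star> w) \<star> (\<lambda>_. 0)) h] (mod 3)"
      using h by (intro conv_mod_cong) auto
    then show ?thesis using h by (simp add: conv_apply)
  qed
  ultimately have "[u (Suc (Suc m)) (g [^] (3 ^ Suc (Suc m) :: nat)) = 0] (mod 3)" using g by simp
  then show ?thesis using frob[OF g, of "Suc (Suc m)"] by (metis cong_sym cong_trans)
qed

section \<open>Kernels invariant under a free abelian action\<close>

locale free_abelian_action = comm_group G for G (structure) +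
  fixes P :: "'p set" and act :: "'a \<Rightarrow> 'p \<Rightarrow> 'p"
  assumes finite_carrier: "finite (carrier G)"
    and finite_space: "finite P"
    and act_closed: "\<And>g x. g \<in> carrier G \<Longrightarrow> x \<in> P \<Longrightarrow> act g x \<in> P"
    and act_one: "\<And>x. x \<in> P \<Longrightarrow> act \<one> x = x"
    and act_mult: "\<And>g h x. g \<in> carrier G \<Longrightarrow> h \<in> carrier G \<Longrightarrow> x \<in> P \<Longrightarrow>
      act (g \<otimes> h) x = act g (act h x)"
    and free: "\<And>g x. g \<in> carrier G \<Longrightarrow> x \<in> P \<Longrightarrow> act g x = x \<Longrightarrow> g = \<one>"
begin

lemma act_inv [simp]:
  assumes "g \<in> carrier G" "x \<in> P"
  shows "act (inv g) (act g x) = x" "act g (act (inv g) x) = x"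
  using act_mult[of "inv g" g x] act_mult[of g "inv g" x] assms act_one by simp_all

lemma transversal:
  obtains X where "X \<subseteq> P" "bij_betw (\<lambda>(g, x). act g x) (carrier G \<times> X) P"
proof -
  let ?S = "carrier G"
  define rep where "rep x = (SOME y. \<exists>g\<in>?S. y = act g x)" for x
  have rep: "\<exists>g\<in>?S. rep x = act g x" for x
    unfolding rep_def by (rule someI_ex) (use one_closed in blast)
  have same: "rep (act h x) = rep x" if "h \<in> ?S" "x \<in> P" for h x
  proof -
    have "(\<exists>g\<in>?S. y = act g (act h x)) \<longleftrightarrow> (\<exists>g\<in>?S. y = act g x)" for y
    proof
      assume "\<exists>g\<in>?S. y = act g (act h x)"
      then show "\<exists>g\<in>?S. y = act g x" using that act_mult by (metis m_closed)
    next
      assume "\<exists>g\<in>?S. y = act g x"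
      then obtain g where g: "g \<in> ?S" "y = act g x" by blast
      then have "y = act (g \<otimes> inv h) (act h x)"
        using that by (simp add: act_mult act_closed)
      then show "\<exists>g\<in>?S. y = act g (act h x)" using g that by blast
    qed
    then show ?thesis by (simp add: rep_def)
  qed
  have repP: "rep x \<in> P" if "x \<in> P" for x using rep[of x] act_closed that by auto
  have idem: "rep (rep x) = rep x" if "x \<in> P" for x using rep[of x] same that by metis
  have "inj_on (\<lambda>(g, x). act g x) (?S \<times> rep ` P)"
  proof (rule inj_onI, clarsimp)
    fix g h x y assume a: "g \<in> ?S" "h \<in> ?S" "x \<in> P" "y \<in> P" "act g (rep x) = act h (rep y)"
    then have "rep (rep x) = rep (rep y)" using same repP by metis
    then have xy: "rep x = rep y" using idem a by simp
    have "act (inv h \<otimes> g) (rep x) = rep x"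
      using a xy repP by (simp add: act_mult)
    then have "inv h \<otimes> g = \<one>" using free[of "inv h \<otimes> g" "rep x"] a repP by simp
    then have "g = h" using a by (metis inv_closed inv_equality inv_inv)
    then show "g = h \<and> rep x = rep y" using xy by simp
  qed
  moreover have "(\<lambda>(g, x). act g x) ` (?S \<times> rep ` P) = P"
  proof
    show "(\<lambda>(g, x). act g x) ` (?S \<times> rep ` P) \<subseteq> P" using act_closed repP by auto
    show "P \<subseteq> (\<lambda>(g, x). act g x) ` (?S \<times> rep ` P)"
    proof
      fix x assume x: "x \<in> P"
      obtain g where g: "g \<in> ?S" "rep x = act g x" using rep by blast
      then have "x = (\<lambda>(g, x). act g x) (inv g, rep x)" using x by simp
      moreover have "(inv g, rep x) \<in> ?S \<times> rep ` P" using g(1) x by blast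
      ultimately show "x \<in> (\<lambda>(g, x). act g x) ` (?S \<times> rep ` P)" by (rule image_eqI)
    qed
  qed
  ultimately have "bij_betw (\<lambda>(g, x). act g x) (?S \<times> rep ` P) P" by (simp add: bij_betw_def)
  then show thesis using that repP by blast
qed

lemma sum_over_orbits:
  fixes u :: "'p \<Rightarrow> int"
  assumes "bij_betw (\<lambda>(g, x). act g x) (carrier G \<times> X) P"
  shows "(\<Sum>p\<in>P. u p) = (\<Sum>x\<in>X. \<Sum>g\<in>carrier G. u (act g x))"
proof -
  have "(\<Sum>p\<in>P. u p) = (\<Sum>(g, x)\<in>carrier G \<times> X. u (act g x))"
    using sum.reindex_bij_betw[OF assms, of u] by (simp add: case_prod_unfold)
  also have "\<dots> = (\<Sum>g\<in>carrier G. \<Sum>x\<in>X. u (act g x))" by (simp add: sum.cartesian_product)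
  also have "\<dots> = (\<Sum>x\<in>X. \<Sum>g\<in>carrier G. u (act g x))" by (rule sum.swap)
  finally show ?thesis .
qed

end

locale invariant_kernel = free_abelian_action G P act
    for G (structure) and P :: "'p set" and act :: "'a \<Rightarrow> 'p \<Rightarrow> 'p" +
  fixes K :: "'p \<Rightarrow> 'p \<Rightarrow> int" and c :: int
  assumes K_sym: "\<And>x y. x \<in> P \<Longrightarrow> y \<in> P \<Longrightarrow> K x y = K y x"
    and K_inv: "\<And>g x y. g \<in> carrier G \<Longrightarrow> x \<in> P \<Longrightarrow> y \<in> P \<Longrightarrow> K (act g x) (act g y) = K x y"
    and K_sq: "\<And>x z. x \<in> P \<Longrightarrow> z \<in> P \<Longrightarrow> (\<Sum>y\<in>P. K x y * K y z) = c * K x z"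
begin

text \<open>
  For \<open>x\<close>, \<open>y\<close> in a set of representatives of the orbits, these are the entries of \<open>K\<close> as a matrix
  over the group ring.
\<close>

definition entry :: "'p \<Rightarrow> 'p \<Rightarrow> 'a \<Rightarrow> int" where "entry x y g = K (act g x) y"

lemma K_shift:
  assumes "g \<in> carrier G" "x \<in> P" "y \<in> P"
  shows "K (act g x) y = K x (act (inv g) y)"
  using K_inv[of g x "act (inv g) y"] assms by (simp add: act_closed)

lemma entry_inv:
  assumes "g \<in> carrier G" "x \<in> P" "y \<in> P"
  shows "entry x y (inv g) = entry y x g"
  using K_shift[of "inv g" x y] K_sym[of x "act g y"] assms by (simp add: entry_def act_closed)

lemma entry_sq:
  assumes X: "X \<subseteq> P" "bij_betw (\<lambda>(g, x). act g x) (carrier G \<times> X) P"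
    and x: "x \<in> P" and z: "z \<in> P" and g: "g \<in> carrier G"
  shows "(\<Sum>y\<in>X. (entry x y \<star> entry y z) g) = c * entry x z g"
proof -
  let ?S = "carrier G"
  have term_eq: "entry x y h * entry y z (inv h \<otimes> g) =
      K x (act (inv h) y) * K (act (inv h) y) (act (inv g) z)"
    if y: "y \<in> X" and h: "h \<in> ?S" for y h
  proof -
    have yP: "y \<in> P" using y X by blast
    have "act (inv h \<otimes> g) y = act g (act (inv h) y)"
      using h g yP by (subst m_comm) (auto simp: act_mult)
    then show ?thesis
      using K_shift[OF h x yP] K_shift[OF g _ z, of "act (inv h) y"] h yP
      by (simp add: entry_def act_closed)
  qed
  have "(\<Sum>y\<in>X. (entry x y \<star> entry y z) g) =
      (\<Sum>y\<in>X. \<Sum>h\<in>?S. K x (act (inv h) y) * K (act (inv h) y) (act (inv g) z))"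
    using term_eq by (simp add: conv_apply[OF g])
  also have "\<dots> = (\<Sum>y\<in>X. \<Sum>h\<in>?S. K x (act h y) * K (act h y) (act (inv g) z))"
    by (intro sum.cong refl sum.reindex_bij_witness[of _ "\<lambda>h. inv h" "\<lambda>h. inv h"]) auto
  also have "\<dots> = (\<Sum>p\<in>P. K x p * K p (act (inv g) z))"
    by (rule sum_over_orbits[OF X(2), symmetric])
  also have "\<dots> = c * K x (act (inv g) z)" using K_sq x z g act_closed by blast
  also have "\<dots> = c * entry x z g" using K_shift[OF g x z] by (simp add: entry_def)
  finally show ?thesis .
qed

lemma dvd_trace_translate:
  assumes c: "c \<noteq> 0" and X: "X \<subseteq> P" "bij_betw (\<lambda>(g, x). act g x) (carrier G \<times> X) P"
    and g: "g \<in> carrier G"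
  shows "c dvd int (Coset.order G) * (\<Sum>x\<in>X. entry x x g)"
proof -
  let ?S = "carrier G"
  have pow: "(act g ^^ m) x = act (g [^] m) x \<and> (act g ^^ m) x \<in> P" if "x \<in> P" for m x
  proof (induction m)
    case 0
    show ?case using that by (simp add: act_one)
  next
    case (Suc m)
    have "act (g [^] Suc m) x = act (g \<otimes> g [^] m) x" using g by (simp add: m_comm)
    then show ?case using Suc g that by (simp add: act_mult act_closed)
  qed
  have "c dvd (\<Sum>x\<in>P. K (act g x) x)"
  proof (rule dvd_trace_of_scaled_idempotent_kernel[OF finite_space c])
    show "0 < Coset.order G" using finite_carrier by (simp add: order_gt_0_iff_finite)
    show "(act g ^^ Coset.order G) x = x" if "x \<in> P" for x
      using pow[OF that] g that by (simp add: pow_order_eq_1 act_one)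
  qed (use g act_closed K_inv K_sq in auto)
  also have "(\<Sum>x\<in>P. K (act g x) x) = (\<Sum>x\<in>X. \<Sum>h\<in>?S. K (act g (act h x)) (act h x))"
    by (rule sum_over_orbits[OF X(2)])
  also have "\<dots> = (\<Sum>x\<in>X. \<Sum>h\<in>?S. entry x x g)"
  proof (intro sum.cong refl)
    fix x h assume x: "x \<in> X" and h: "h \<in> ?S"
    have xP: "x \<in> P" using x X by blast
    have "act g (act h x) = act h (act g x)"
      using g h xP by (metis act_mult m_comm)
    then show "K (act g (act h x)) (act h x) = entry x x g"
      using K_inv[OF h _ xP] g xP by (simp add: entry_def act_closed)
  qed
  also have "\<dots> = int (Coset.order G) * (\<Sum>x\<in>X. entry x x g)"
    by (simp add: Coset.order_def sum_distrib_left)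
  finally show ?thesis .
qed

end

section \<open>Free actions of an abelian group of order 49\<close>

text \<open>
  Apart from \<open>4 * 12 * 27 = 36\<^sup>2\<close>, no number \<open>4 * n * n'\<close> with distinct positive \<open>n, n' < 32\<close> of
  this residue class is a square, and the hypothesis \<open>n < 12\<close> excludes that case.
\<close>

lemma product_square_cases:
  fixes n n' q :: int
  assumes n: "n mod 5 = 2" "0 < n" "n < 32" and n': "n' mod 5 = 2" "0 < n'" "n' < 32"
    and sq: "4 * n * n' = q\<^sup>2" and small: "n < 12"
  shows "n' = n"
proof -
  have n_cases: "n \<in> {2, 7}" using n small by (simp, presburger)
  have n'_cases: "n' \<in> {2, 7, 12, 17, 22, 27}" using n' by (simp, presburger)
  have no: "q\<^sup>2 \<noteq> m" if "r\<^sup>2 < m" "m < (r + 1)\<^sup>2" "0 \<le> r" for m r :: int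
  proof
    assume "q\<^sup>2 = m"
    then have "r < \<bar>q\<bar>" "\<bar>q\<bar> < r + 1"
      using that power2_less_imp_less[of r "\<bar>q\<bar>"] power2_less_imp_less[of "\<bar>q\<bar>" "r + 1"] by auto
    then show False by simp
  qed
  show ?thesis
    using n_cases n'_cases sq no[of 7 56] no[of 9 96] no[of 11 136] no[of 13 176] no[of 14 216]
      no[of 18 336] no[of 21 476] no[of 24 616] no[of 27 756]
    by auto
qed

text \<open>
  The numbers \<open>\<sigma> x y\<close>, the sums of the coefficients of \<open>entry x y\<close>, satisfy
  \<open>\<sigma> x x * \<sigma> y y = (\<sigma> x y)\<^sup>2\<close> by the vanishing of the minors, and the five diagonal ones sum to 80. If
  \<open>d\<close> of the 48 coefficients of \<open>entry x x\<close> away from \<open>\<one>\<close> are \<open>-4\<close>, then \<open>\<sigma> x x = 64 - 5 * d\<close>, with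
  \<open>d\<close> even because the coefficients at \<open>g\<close> and \<open>inv g\<close> agree. Arithmetic then leaves only the
  diagonal sums \<open>64, 4, 4, 4, 4\<close>, of which the part \<open>\<sigma> x x = 64\<close> is what the final argument modulo 3
  starts from.
\<close>

lemma (in invariant_kernel) no_kernel_with_values_16_m4_1:
  assumes ord: "Coset.order G = 49" and cP: "card P = 245" and c: "c = 80"
    and K_diag: "\<And>x. x \<in> P \<Longrightarrow> K x x = 16"
    and K_off: "\<And>x y. x \<in> P \<Longrightarrow> y \<in> P \<Longrightarrow> x \<noteq> y \<Longrightarrow> K x y = 1 \<or> K x y = -4"
  shows False
proof -
  let ?S = "carrier G"
  have cS: "card ?S = 49" using ord by (simp add: Coset.order_def)
  obtain X where X: "X \<subseteq> P" "bij_betw (\<lambda>(g, x). act g x) (?S \<times> X) P"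
    by (rule transversal)
  have XP: "x \<in> P" if "x \<in> X" for x using that X by blast
  have finX: "finite X" using X(1) finite_space finite_subset by blast
  have "card ?S * card X = card P"
    using bij_betw_same_card[OF X(2)] by (simp add: card_cartesian_product)
  then have cX: "card X = 5" using cS cP by simp
  have entry_one: "entry x x \<one> = 16" if "x \<in> X" for x
    using that by (simp add: entry_def act_one XP K_diag)
  have entry_off: "entry x y g = 1 \<or> entry x y g = -4"
    if "x \<in> X" "y \<in> X" "g \<in> ?S" "x \<noteq> y \<or> g \<noteq> \<one>" for x y g
  proof -
    have "act g x \<noteq> y"
    proof
      assume e: "act g x = y"
      then have "(\<lambda>(g, x). act g x) (g, x) = (\<lambda>(g, x). act g x) (\<one>, y)"
        using that by (simp add: act_one XP)
      then have "(g, x) = (\<one>, y)"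
        by (rule inj_onD[OF bij_betw_imp_inj_on[OF X(2)]]) (use that in simp_all)
      then show False using that by simp
    qed
    then show ?thesis using K_off[of "act g x" y] that act_closed XP by (auto simp: entry_def)
  qed
  have trace: "(\<Sum>x\<in>X. entry x x g) = (if g = \<one> then 80 else 0)" if g: "g \<in> ?S" for g
  proof (cases "g = \<one>")
    case True
    then show ?thesis by (simp add: entry_one cX)
  next
    case False
    let ?s = "\<Sum>x\<in>X. entry x x g"
    have "80 dvd 49 * ?s" using dvd_trace_translate[OF _ X g] c ord by simp
    moreover have "?s \<le> (\<Sum>x\<in>X. 1)"
      by (rule sum_mono) (use entry_off[of _ _ g] g False in force)
    moreover have "(\<Sum>x\<in>X. -4) \<le> ?s"
      by (rule sum_mono) (use entry_off[of _ _ g] g False in force)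
    ultimately have s: "80 dvd 49 * ?s" "?s \<le> 5" "-20 \<le> ?s" using cX by simp_all
    \<comment> \<open>\<open>49 * 49 - 80 * 30 = 1\<close>\<close>
    have "80 dvd 49 * (49 * ?s) - 80 * (30 * ?s)"
      by (intro dvd_diff dvd_triv_left dvd_mult s(1))
    then have "80 dvd ?s" by simp
    moreover have "\<bar>?s\<bar> < 80" using s by linarith
    ultimately have "?s = 0" using dvd_imp_le_int[of ?s 80] by fastforce
    then show ?thesis using False by simp
  qed
  have rank_one: "entry x y \<star> entry z w = entry x w \<star> entry z y"
    if "x \<in> X" "y \<in> X" "z \<in> X" "w \<in> X" for x y z w
    by (rule hermitian_scaled_idempotent_rank_one[OF finite_carrier finX, where c = 80])
      (use that entry_inv entry_sq[OF X] XP trace c in auto)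
  define \<sigma> where "\<sigma> x y = (\<Sum>g\<in>?S. entry x y g)" for x y
  have \<sigma>_sym: "\<sigma> x y = \<sigma> y x" if "x \<in> X" "y \<in> X" for x y
    unfolding \<sigma>_def
    by (rule sum.reindex_bij_witness[of _ "\<lambda>h. inv h" "\<lambda>h. inv h"])
      (use that XP entry_inv[of _ y x] entry_inv[of _ x y] in auto)
  have \<sigma>_sq: "\<sigma> x x * \<sigma> y y = (\<sigma> x y)\<^sup>2" if "x \<in> X" "y \<in> X" for x y
    using arg_cong[OF rank_one[of x x y y], of "\<lambda>a. \<Sum>g\<in>?S. a g"] that
    by (simp add: sum_conv power2_eq_square \<sigma>_sym[of y x] flip: \<sigma>_def)
  have "(\<Sum>x\<in>X. \<sigma> x x) = (\<Sum>g\<in>?S. \<Sum>x\<in>X. entry x x g)" unfolding \<sigma>_def by (rule sum.swap)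
  also have "\<dots> = 80" using finite_carrier by (simp add: trace)
  finally have \<sigma>_sum: "(\<Sum>x\<in>X. \<sigma> x x) = 80" .
  have \<sigma>_diag: "\<sigma> x x = 16 + (\<Sum>g\<in>?S - {\<one>}. entry x x g)" if "x \<in> X" for x
    using that finite_carrier by (simp add: \<sigma>_def sum.remove[of ?S \<one>] entry_one)
  have card_rest: "card (?S - {\<one>}) = 48" using cS finite_carrier by simp
  have \<sigma>_le: "\<sigma> x x \<le> 64" if "x \<in> X" for x
  proof -
    have "(\<Sum>g\<in>?S - {\<one>}. entry x x g) \<le> (\<Sum>g\<in>?S - {\<one>}. 1)"
      by (rule sum_mono) (use entry_off[of x x] that in force)
    then show ?thesis using \<sigma>_diag[OF that] card_rest by simp
  qed
  have \<sigma>_mod5: "\<sigma> x x mod 5 = 4" if "x \<in> X" for x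
  proof -
    have "[(\<Sum>g\<in>?S - {\<one>}. entry x x g) = (\<Sum>g\<in>?S - {\<one>}. 1)] (mod 5)"
      by (rule cong_sum) (use entry_off[of x x] that in \<open>force simp: cong_def\<close>)
    then have "[\<sigma> x x = 16 + 48] (mod 5)"
      unfolding \<sigma>_diag[OF that] using card_rest by (intro cong_add) auto
    then show ?thesis by (simp add: cong_def)
  qed
  have \<sigma>_even: "even (\<sigma> x x)" if x: "x \<in> X" for x
  proof -
    have inv_fixed: "g = \<one>" if g: "g \<in> ?S" "inv g = g" for g
    proof -
      have "g [^] (49::nat) = \<one>" using pow_order_eq_1[OF g(1)] ord by simp
      moreover have "g [^] (2::nat) = \<one>" using g r_inv[OF g(1)] by (simp add: numeral_2_eq_2)
      then have "g [^] (48::nat) = \<one>" using nat_pow_pow[OF g(1), of 2 24] by simp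
      then have "g = g [^] (49::nat)"
        using nat_pow_mult[OF g(1), of 48 1] g(1) by simp
      ultimately show ?thesis by simp
    qed
    have "[\<sigma> x x = (\<Sum>g\<in>{g\<in>?S. inv g = g}. entry x x g)] (mod int 2)"
      unfolding \<sigma>_def
      by (rule sum_cong_sum_fixed_points[OF two_is_prime_nat])
        (use finite_carrier entry_inv XP x in \<open>auto simp: numeral_2_eq_2\<close>)
    also have "{g\<in>?S. inv g = g} = {\<one>}" using inv_fixed by auto
    finally show ?thesis using entry_one[OF x] by (simp add: cong_def even_iff_mod_2_eq_zero)
  qed
  \<comment> \<open>Otherwise the numbers \<open>\<sigma> x x div 2\<close> lie in \<open>{2, 7, 12, 17, 22, 27}\<close> and sum to 40: all equal if one is below 12, and too large if none is.\<close>
  have "\<exists>x\<in>X. \<sigma> x x = 64"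
  proof (rule ccontr)
    assume no64: "\<not> (\<exists>x\<in>X. \<sigma> x x = 64)"
    define n where "n x = \<sigma> x x div 2" for x
    have \<sigma>n: "\<sigma> x x = 2 * n x" if "x \<in> X" for x using \<sigma>_even[OF that] by (simp add: n_def)
    have n_mod: "n x mod 5 = 2" if "x \<in> X" for x
      using \<sigma>_mod5[OF that] \<sigma>n[OF that] by presburger
    have n_lt: "n x < 32" if "x \<in> X" for x
      using \<sigma>_le[OF that] \<sigma>n[OF that] no64 that by force
    have n_sum: "(\<Sum>x\<in>X. n x) = 40"
      using \<sigma>_sum by (simp add: \<sigma>n flip: sum_distrib_left)
    have n_sq: "4 * n x * n y = (\<sigma> x y)\<^sup>2" if "x \<in> X" "y \<in> X" for x y
      using \<sigma>_sq[OF that] that by (simp add: \<sigma>n)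
    obtain z where z: "z \<in> X" "0 < n z"
      using n_sum sum_nonpos[of X n] by (metis not_le zero_less_numeral)
    have n_pos: "0 < n x" if "x \<in> X" for x
    proof -
      have "0 \<le> n x * n z" using n_sq[OF that z(1)] zero_le_power2[of "\<sigma> x z"] by linarith
      then have "0 \<le> n x" using z(2) by (simp add: zero_le_mult_iff)
      then show ?thesis using n_mod[OF that] by (cases "n x = 0") auto
    qed
    show False
    proof (cases "\<exists>x\<in>X. n x < 12")
      case True
      then obtain x where x: "x \<in> X" "n x < 12" by blast
      have "n y = n x" if "y \<in> X" for y
        by (rule product_square_cases[OF n_mod[OF x(1)] n_pos[OF x(1)] n_lt[OF x(1)]
              n_mod[OF that] n_pos[OF that] n_lt[OF that] n_sq[OF x(1) that] x(2)])
      then have "5 * n x = 40" using n_sum cX by simp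
      then show False using n_mod[OF x(1)] by presburger
    next
      case False
      then have "(\<Sum>x\<in>X. 12) \<le> (\<Sum>x\<in>X. n x)" by (intro sum_mono) auto
      then show False using n_sum cX by simp
    qed
  qed
  then obtain x where x: "x \<in> X" "\<sigma> x x = 64" by blast
  have entry_xx: "entry x x g = 1" if g: "g \<in> ?S" "g \<noteq> \<one>" for g
  proof -
    have "(\<Sum>g\<in>?S - {\<one>}. 1 - entry x x g) = 0"
      using \<sigma>_diag[OF x(1)] x(2) card_rest by (simp add: sum_subtractf)
    then have "1 - entry x x g = 0"
      using g finite_carrier entry_off[of x x] x(1) by (subst (asm) sum_nonneg_eq_0_iff) force+
    then show ?thesis by simp
  qed
  obtain y where y: "y \<in> X" "y \<noteq> x"
  proof -
    have "X \<noteq> {x}" using cX by auto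
    then show thesis using x(1) that by blast
  qed
  let ?s = "\<sigma> y x"
  have s_sq: "?s\<^sup>2 = 64 * \<sigma> y y" using \<sigma>_sq[OF y(1) x(1)] x(2) by simp
  have prod: "(entry y x \<star> entry x y) g = 15 * entry y y g + \<sigma> y y" if g: "g \<in> ?S" for g
  proof -
    have "(entry y x \<star> entry x y) g = (entry x x \<star> entry y y) g"
      using rank_one[of x x y y] x y by (simp add: conv_commute[of "entry y x"])
    also have "(entry x x \<star> entry y y) g = (\<Sum>h\<in>?S. (15 * (if h = \<one> then 1 else 0) + 1) * entry y y (inv h \<otimes> g))"
      unfolding conv_apply[OF g] by (intro sum.cong refl) (auto simp: entry_xx entry_one x(1))
    also have "\<dots> = (\<Sum>h\<in>?S. if h = \<one> then 15 * entry y y g else 0) + (\<Sum>h\<in>?S. entry y y (inv h \<otimes> g))"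
      unfolding sum.distrib[symmetric] using g by (intro sum.cong refl) auto
    also have "(\<Sum>h\<in>?S. entry y y (inv h \<otimes> g)) = \<sigma> y y"
      unfolding \<sigma>_def
      by (rule sum.reindex_bij_witness[of _ "\<lambda>h. g \<otimes> inv h" "\<lambda>h. inv h \<otimes> g"])
        (use g in \<open>auto simp: inv_mult m_assoc m_comm[of g]\<close>)
    finally show ?thesis using finite_carrier by simp
  qed
  \<comment> \<open>Subtracting the multiple \<open>?s\<close> of the sum of all group elements makes the product vanish modulo 3, because \<open>49\<close> is 1 modulo 3.\<close>
  define f where "f g = entry y x g - ?s" for g
  define f' where "f' g = entry x y g - ?s" for g
  have f_cong: "[f g = 0] (mod 3)" if g: "g \<in> ?S" for g
  proof (rule conv_star_cong_0_imp_cong_0[OF finite_carrier _ _ _ g])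
    \<comment> \<open>3 is a primitive root modulo 49, so \<open>3 ^ 21\<close> is \<open>-1\<close> there.\<close>
    show "Coset.order G dvd 3 ^ Suc 20 + 1" by (simp add: ord)
    show "f' h = f (inv h)" if "h \<in> ?S" for h
      using entry_inv[OF that] XP x y by (simp add: f_def f'_def)
    show "[(f \<star> f') h = 0] (mod 3)" if h: "h \<in> ?S" for h
    proof -
      have shift: "(\<Sum>a\<in>?S. entry x y (inv a \<otimes> h)) = ?s"
        unfolding \<sigma>_sym[OF y(1) x(1)] unfolding \<sigma>_def
        by (rule sum.reindex_bij_witness[of _ "\<lambda>a. h \<otimes> inv a" "\<lambda>a. inv a \<otimes> h"])
          (use h in \<open>auto simp: inv_mult m_assoc m_comm[of h]\<close>)
      have "(f \<star> f') h = (\<Sum>a\<in>?S. entry y x a * entry x y (inv a \<otimes> h)) - ?s * (\<Sum>a\<in>?S. entry y x a)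
          - ?s * (\<Sum>a\<in>?S. entry x y (inv a \<otimes> h)) + (\<Sum>a\<in>?S. ?s * ?s)"
        unfolding conv_apply[OF h] f_def f'_def
        by (simp add: algebra_simps sum.distrib sum_subtractf sum_distrib_left)
      also have "\<dots> = (15 * entry y y h + \<sigma> y y) - ?s * ?s - ?s * ?s + 49 * (?s * ?s)"
        using prod[OF h] by (simp add: conv_apply[OF h] shift cS flip: \<sigma>_def)
      also have "\<dots> = 3 * (5 * entry y y h + 1003 * \<sigma> y y)"
        using s_sq by (simp add: power2_eq_square)
      finally show ?thesis by (simp add: cong_0_iff)
    qed
  qed
  have const: "entry y x g = entry y x \<one>" if g: "g \<in> ?S" for g
  proof -
    have "3 dvd f g - f \<one>" using f_cong[OF g] f_cong[OF one_closed] by (simp add: cong_0_iff)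
    then show ?thesis
      using entry_off[OF y(1) x(1) g] entry_off[OF y(1) x(1) one_closed] y(2) by (auto simp: f_def)
  qed
  have "?s = (\<Sum>g\<in>?S. entry y x \<one>)" unfolding \<sigma>_def by (rule sum.cong[OF refl const])
  then have "?s = 49 * entry y x \<one>" by (simp add: cS)
  then have "?s = 49 \<or> ?s = -196" using entry_off[OF y(1) x(1) one_closed] y(2) by auto
  then have "64 * \<sigma> y y = 2401 \<or> 64 * \<sigma> y y = 38416" using s_sq by auto
  then show False by presburger
qed

section \<open>Counting in a generalized quadrangle\<close>

context generalized_quadrangle
begin

definition inc :: "'p \<Rightarrow> 'l \<Rightarrow> int" where "inc x l = (if (x, l) \<in> I then 1 else 0)"

definition joins :: "'p \<Rightarrow> 'p \<Rightarrow> int" where "joins x y = (\<Sum>l\<in>L. inc x l * inc y l)"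

lemma sum_inc_eq_card:
  "finite A \<Longrightarrow> (\<Sum>l\<in>A. inc x l) = int (card {l \<in> A. (x, l) \<in> I})"
  "finite B \<Longrightarrow> (\<Sum>x\<in>B. inc x l) = int (card {x \<in> B. (x, l) \<in> I})"
  by (simp_all add: inc_def sum.If_cases Int_def)

lemma sum_inc_lines: "x \<in> P \<Longrightarrow> (\<Sum>l\<in>L. inc x l) = int t + 1"
  using sum_inc_eq_card(1)[OF finite_lines] card_lines_on_point by simp

lemma sum_inc_points: "l \<in> L \<Longrightarrow> (\<Sum>x\<in>P. inc x l) = int s + 1"
  using sum_inc_eq_card(2)[OF finite_points] card_points_on_line by simp

lemma joins_commute: "joins x y = joins y x"
  by (simp add: joins_def mult.commute)

lemma sum_joins:
  assumes "x \<in> P"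
  shows "(\<Sum>y\<in>P. joins x y) = (int s + 1) * (int t + 1)"
proof -
  have "(\<Sum>y\<in>P. joins x y) = (\<Sum>l\<in>L. \<Sum>y\<in>P. inc x l * inc y l)"
    unfolding joins_def by (rule sum.swap)
  also have "\<dots> = (\<Sum>l\<in>L. inc x l * (int s + 1))"
    by (simp add: sum_inc_points flip: sum_distrib_left)
  also have "\<dots> = (int s + 1) * (int t + 1)"
    by (simp add: sum_inc_lines[OF assms] flip: sum_distrib_right)
  finally show ?thesis .
qed

text \<open>
  Counting the lines through \<open>z\<close> with their intersections with \<open>l\<close>: exactly one meets \<open>l\<close> if \<open>z\<close> is not
  on \<open>l\<close>; otherwise \<open>l\<close> itself contributes its \<open>s + 1\<close> points and each of the \<open>t\<close> others the point \<open>z\<close>.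
\<close>

lemma sum_meeting_lines:
  assumes z: "z \<in> P" and l: "l \<in> L"
  shows "(\<Sum>k\<in>L. \<Sum>y\<in>P. inc y l * inc y k * inc z k) = 1 + (int s + int t) * inc z l"
proof (cases "(z, l) \<in> I")
  case False
  let ?Q = "\<lambda>(y, k). y \<in> P \<and> k \<in> L \<and> (z, k) \<in> I \<and> (y, k) \<in> I \<and> (y, l) \<in> I"
  have "(\<Sum>k\<in>L. \<Sum>y\<in>P. inc y l * inc y k * inc z k) =
      (\<Sum>(y, k)\<in>P \<times> L. inc y l * inc y k * inc z k)"
    by (subst sum.swap) (simp add: sum.cartesian_product)
  also have "\<dots> = (\<Sum>q\<in>P \<times> L. if ?Q q then 1 else 0)"
    by (rule sum.cong) (auto simp: inc_def split: if_splits)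
  also have "\<dots> = int (card {q \<in> P \<times> L. ?Q q})"
    using finite_points finite_lines by (simp add: sum.If_cases Int_def)
  also have "{q \<in> P \<times> L. ?Q q} = {q. ?Q q}" by auto
  also have "card {q. ?Q q} = 1"
  proof -
    obtain q where "?Q q" "\<And>q'. ?Q q' \<Longrightarrow> q' = q"
      using unique_projection[OF z l False] by (auto elim!: ex1E)
    then have "{q. ?Q q} = {q}" by blast
    then show ?thesis by simp
  qed
  finally show ?thesis using False by (simp add: inc_def)
next
  case True
  have meet: "(\<Sum>y\<in>P. inc y l * inc y k * inc z k) = inc z k" if k: "k \<in> L - {l}" for k
  proof (cases "(z, k) \<in> I")
    case zk: True
    have "(\<Sum>y\<in>P. inc y l * inc y k * inc z k) = (\<Sum>y\<in>P. if y = z then 1 else 0)"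
      using at_most_one_point[OF l, of k] k True zk z by (intro sum.cong) (auto simp: inc_def)
    then show ?thesis using z zk finite_points by (simp add: inc_def)
  qed (simp add: inc_def)
  have "(\<Sum>k\<in>L. \<Sum>y\<in>P. inc y l * inc y k * inc z k) =
      (\<Sum>y\<in>P. inc y l * inc y l * inc z l) + (\<Sum>k\<in>L - {l}. inc z k)"
    using meet by (subst sum.remove[OF finite_lines l]) simp
  also have "(\<Sum>y\<in>P. inc y l * inc y l * inc z l) = (\<Sum>y\<in>P. inc y l)"
    using True by (intro sum.cong) (auto simp: inc_def)
  also have "(\<Sum>k\<in>L - {l}. inc z k) = int t"
    using sum.remove[OF finite_lines l, of "inc z"] sum_inc_lines[OF z] True by (simp add: inc_def)
  finally show ?thesis using sum_inc_points[OF l] True by (simp add: inc_def)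
qed

text \<open>
  The matrix \<open>joins\<close> is the product of the incidence matrix with its transpose, and this is its
  quadratic equation. It determines the size of \<open>P\<close> and all that is needed of the collinearity graph.
\<close>

lemma joins_square:
  assumes x: "x \<in> P" and z: "z \<in> P"
  shows "(\<Sum>y\<in>P. joins x y * joins y z) = (int s + int t) * joins x z + (int t + 1)"
proof -
  have "(\<Sum>y\<in>P. joins x y * joins y z) =
      (\<Sum>y\<in>P. \<Sum>l\<in>L. \<Sum>k\<in>L. inc x l * (inc y l * inc y k * inc z k))"
    by (simp add: joins_def sum_product mult.assoc)
  also have "\<dots> = (\<Sum>l\<in>L. \<Sum>y\<in>P. \<Sum>k\<in>L. inc x l * (inc y l * inc y k * inc z k))"
    by (rule sum.swap)
  also have "\<dots> = (\<Sum>l\<in>L. \<Sum>k\<in>L. \<Sum>y\<in>P. inc x l * (inc y l * inc y k * inc z k))"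
    by (intro sum.cong[OF refl] sum.swap)
  also have "\<dots> = (\<Sum>l\<in>L. inc x l * (1 + (int s + int t) * inc z l))"
    by (simp add: sum_meeting_lines[OF z] flip: sum_distrib_left)
  also have "\<dots> = (\<Sum>l\<in>L. inc x l) + (int s + int t) * joins x z"
    by (simp add: joins_def algebra_simps sum.distrib sum_distrib_left)
  finally show ?thesis by (simp add: sum_inc_lines[OF x])
qed

lemma card_points: "int (card P) = (int s + 1) * (int s * int t + 1)"
proof -
  obtain x where x: "x \<in> P" using points_nonempty by blast
  let ?r = "(int s + 1) * (int t + 1)"
  have "(\<Sum>z\<in>P. \<Sum>y\<in>P. joins x y * joins y z) = (\<Sum>y\<in>P. \<Sum>z\<in>P. joins x y * joins y z)"
    by (rule sum.swap)
  also have "\<dots> = ?r * ?r"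
    using sum_joins x by (simp flip: sum_distrib_left sum_distrib_right)
  finally have "(\<Sum>z\<in>P. (int s + int t) * joins x z + (int t + 1)) = ?r * ?r"
    using joins_square[OF x] by simp
  then have "(int s + int t) * ?r + int (card P) * (int t + 1) = ?r * ?r"
    by (simp add: sum.distrib sum_joins[OF x] flip: sum_distrib_left)
  then have "(int t + 1) * int (card P) = (int t + 1) * ((int s + 1) * (int s * int t + 1))"
    by (simp add: algebra_simps)
  then show ?thesis by simp
qed

lemma card_flags: "(int s + 1) * int (card L) = (int t + 1) * int (card P)"
proof -
  have "(int s + 1) * int (card L) = (\<Sum>l\<in>L. \<Sum>x\<in>P. inc x l)" by (simp add: sum_inc_points)
  also have "\<dots> = (\<Sum>x\<in>P. \<Sum>l\<in>L. inc x l)" by (rule sum.swap)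
  finally show ?thesis by (simp add: sum_inc_lines)
qed

text \<open>
  A multiple of the orthogonal projection onto the eigenspace of the collinearity graph for its
  smallest eigenvalue \<open>- t - 1\<close>, scaled to have integer entries.
\<close>

definition eigenspace_kernel :: "'p \<Rightarrow> 'p \<Rightarrow> int" where
  "eigenspace_kernel x y = (if x = y then (int s)\<^sup>2 else if collinear L I x y then - int s else 1)"

lemma joins_eq:
  assumes "x \<in> P" "y \<in> P"
  shows "joins x y = (if x = y then int t + 1 else if collinear L I x y then 1 else 0)"
proof -
  have eq: "joins x y = int (card {l \<in> L. (x, l) \<in> I \<and> (y, l) \<in> I})"
  proof -
    have "joins x y = (\<Sum>l\<in>L. if (x, l) \<in> I \<and> (y, l) \<in> I then 1 else 0)"
      unfolding joins_def by (rule sum.cong) (auto simp: inc_def)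
    then show ?thesis using finite_lines by (simp add: sum.If_cases Int_def)
  qed
  consider "x = y" | "x \<noteq> y" "collinear L I x y" | "x \<noteq> y" "\<not> collinear L I x y" by blast
  then show ?thesis
  proof cases
    case 1
    then show ?thesis using eq card_lines_on_point[OF assms(1)] by simp
  next
    case 2
    then obtain l where l: "l \<in> L" "(x, l) \<in> I" "(y, l) \<in> I" by (auto simp: collinear_def)
    then have "{l \<in> L. (x, l) \<in> I \<and> (y, l) \<in> I} = {l}"
      using at_most_one_line[OF assms 2(1)] by blast
    then show ?thesis using eq 2 by simp
  next
    case 3
    then have none: "{l \<in> L. (x, l) \<in> I \<and> (y, l) \<in> I} = {}" by (auto simp: collinear_def)
    show ?thesis using 3 unfolding eq none by simp
  qed
qed

lemma eigenspace_kernel_eq_joins: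
  assumes "x \<in> P" "y \<in> P"
  shows "eigenspace_kernel x y = (int s + 1) * ((if x = y then int s + int t else 0) - joins x y) + 1"
  using assms by (simp add: eigenspace_kernel_def joins_eq power2_eq_square algebra_simps)

lemma eigenspace_kernel_square:
  assumes x: "x \<in> P" and z: "z \<in> P"
  shows "(\<Sum>y\<in>P. eigenspace_kernel x y * eigenspace_kernel y z) = (int s + 1) * (int s + int t) * eigenspace_kernel x z"
proof -
  let ?a = "int s + 1" and ?b = "int s + int t"
  let ?\<delta> = "\<lambda>x y :: 'p. if x = y then 1 else (0 :: int)"
  have expand: "(a * (b * d - j) + 1) * (a * (b * d' - j') + 1) =
      a\<^sup>2 * b\<^sup>2 * (d * d') - a\<^sup>2 * b * (d * j') - a\<^sup>2 * b * (j * d') + a\<^sup>2 * (j * j')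
      + a * b * d + a * b * d' - a * j - a * j' + 1" for a b d d' j j' :: int
    by (simp add: power2_eq_square algebra_simps)
  have "(\<Sum>y\<in>P. eigenspace_kernel x y * eigenspace_kernel y z) =
      (\<Sum>y\<in>P. (?a * (?b * ?\<delta> x y - joins x y) + 1) * (?a * (?b * ?\<delta> y z - joins y z) + 1))"
    using x z by (intro sum.cong) (auto simp: eigenspace_kernel_eq_joins)
  also have "\<dots> = (\<Sum>y\<in>P. ?a\<^sup>2 * ?b\<^sup>2 * (?\<delta> x y * ?\<delta> y z) - ?a\<^sup>2 * ?b * (?\<delta> x y * joins y z)
      - ?a\<^sup>2 * ?b * (joins x y * ?\<delta> y z) + ?a\<^sup>2 * (joins x y * joins y z)
      + ?a * ?b * ?\<delta> x y + ?a * ?b * ?\<delta> y z - ?a * joins x y - ?a * joins y z + 1)"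
    by (intro sum.cong refl expand)
  also have "\<dots> = ?a\<^sup>2 * ?b\<^sup>2 * (\<Sum>y\<in>P. ?\<delta> x y * ?\<delta> y z) - ?a\<^sup>2 * ?b * (\<Sum>y\<in>P. ?\<delta> x y * joins y z)
      - ?a\<^sup>2 * ?b * (\<Sum>y\<in>P. joins x y * ?\<delta> y z) + ?a\<^sup>2 * (\<Sum>y\<in>P. joins x y * joins y z)
      + ?a * ?b * (\<Sum>y\<in>P. ?\<delta> x y) + ?a * ?b * (\<Sum>y\<in>P. ?\<delta> y z)
      - ?a * (\<Sum>y\<in>P. joins x y) - ?a * (\<Sum>y\<in>P. joins y z) + int (card P)"
    by (simp only: sum.distrib sum_subtractf sum_distrib_left[symmetric]) simp
  also have "(\<Sum>y\<in>P. ?\<delta> x y * ?\<delta> y z) = ?\<delta> x z"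
    using x finite_points by (simp add: if_distrib[of "\<lambda>u. u * _"] cong: if_cong)
  also have "(\<Sum>y\<in>P. ?\<delta> x y * joins y z) = joins x z"
    using x finite_points by (simp add: if_distrib[of "\<lambda>u. u * _"] cong: if_cong)
  also have "(\<Sum>y\<in>P. joins x y * ?\<delta> y z) = joins x z"
    using z finite_points by (simp add: if_distrib[of "\<lambda>u. _ * u"] cong: if_cong)
  also have "(\<Sum>y\<in>P. ?\<delta> x y) = 1" using x finite_points by simp
  also have "(\<Sum>y\<in>P. ?\<delta> y z) = 1" using z finite_points by simp
  also have "(\<Sum>y\<in>P. joins y z) = ?a * (int t + 1)"
    using sum_joins[OF z] by (simp add: joins_commute[of _ z])
  finally show ?thesis
    unfolding joins_square[OF x z] sum_joins[OF x] card_points eigenspace_kernel_eq_joins[OF x z]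
    by (cases "x = z") (simp_all add: power2_eq_square algebra_simps)
qed

section \<open>Automorphisms with a fixed point\<close>

text \<open>
  Since \<open>s + 1 < p\<close>, a fixed line consists of fixed points, and each fixed point is on at least
  \<open>(t + 1) mod p\<close> fixed lines. Take a fixed line \<open>l0\<close> and a moved point \<open>y\<close>. Besides the point \<open>u\<close>
  of \<open>l0\<close> collinear with \<open>y\<close> there are \<open>s\<close> points on \<open>l0\<close>, which together are on at least
  \<open>s * ((t + 1) mod p - 1)\<close> fixed lines other than \<open>l0\<close>. Projecting \<open>y\<close> to these gives distinct
  fixed points, as there are no triangles, and joining \<open>y\<close> to them gives distinct lines, as a line
  through two fixed points would be fixed and so would be \<open>y\<close>. This exceeds the \<open>t + 1\<close> lines on \<open>y\<close>.
\<close>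

theorem automorphism_eq_id_of_large_prime_order:
  assumes g: "g \<in> automorphisms P L I" and p: "prime p"
    and per: "\<And>x. x \<in> P \<Longrightarrow> (g ^^ p) x = x"
    and small_s: "s + 1 < p" and large_rest: "t + 1 < s * ((t + 1) mod p - 1)"
    and x0: "x0 \<in> P" "g x0 = x0" and y: "y \<in> P"
  shows "g y = y"
proof (rule ccontr)
  assume y_moved: "g y \<noteq> y"
  define ga where "ga = line_action P L I g"
  have bij: "bij_betw g P P" using g by (auto simp: automorphisms_def Bij_def)
  have gP: "g x \<in> P" if "x \<in> P" for x using bij that by (auto simp: bij_betw_def)
  have gaL: "ga l \<in> L" if "l \<in> L" for l using line_action(1)[OF g that] by (simp add: ga_def)
  have ga_iff: "(g x, ga l) \<in> I \<longleftrightarrow> (x, l) \<in> I" if "x \<in> P" "l \<in> L" for x l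
    using line_action(2)[OF g that(2,1)] by (simp add: ga_def)
  have iter: "(g ^^ k) x \<in> P \<and> (ga ^^ k) l \<in> L \<and> (((g ^^ k) x, (ga ^^ k) l) \<in> I \<longleftrightarrow> (x, l) \<in> I)"
    if "x \<in> P" "l \<in> L" for k x l
    by (induction k) (use that gP gaL ga_iff in auto)
  have ga_per: "(ga ^^ p) l = l" if l: "l \<in> L" for l
    using iter[OF _ l, of _ p] per x0 l by (intro line_eqI) auto
  have fixed_line: "g x = x" if l: "l \<in> L" "ga l = l" and x: "x \<in> P" "(x, l) \<in> I" for x l
  proof (rule ccontr)
    assume ne: "g x \<noteq> x"
    let ?A = "{x \<in> P. (x, l) \<in> I}"
    have fin: "finite ?A" using finite_points by simp
    have "p dvd card {x \<in> ?A. g x \<noteq> x}"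
    proof (rule prime_dvd_card_moved_points[OF p fin])
      show "g a \<in> ?A" if "a \<in> ?A" for a using that gP ga_iff[of a l] l by auto
    qed (use per in auto)
    moreover have "card {x \<in> ?A. g x \<noteq> x} > 0"
      using ne x finite_points by (auto simp: card_gt_0_iff)
    moreover have "card {x \<in> ?A. g x \<noteq> x} \<le> card ?A" using fin by (intro card_mono) auto
    ultimately show False
      using card_points_on_line[OF l(1)] small_s by (auto dest: dvd_imp_le)
  qed
  define fixed where "fixed x = {l \<in> L. (x, l) \<in> I \<and> ga l = l}" for x
  have fin_fixed: "finite (fixed x)" for x using finite_lines by (simp add: fixed_def)
  have fixed_point: "(t + 1) mod p \<le> card (fixed x)" if x: "x \<in> P" "g x = x" for x
  proof -
    let ?A = "{l \<in> L. (x, l) \<in> I}"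
    have fin: "finite ?A" using finite_lines by simp
    have "p dvd card {l \<in> ?A. ga l \<noteq> l}"
    proof (rule prime_dvd_card_moved_points[OF p fin])
      show "ga l \<in> ?A" if "l \<in> ?A" for l using that gaL ga_iff[of x l] x by auto
    qed (use ga_per in auto)
    then obtain j where j: "card {l \<in> ?A. ga l \<noteq> l} = p * j" by (auto elim: dvdE)
    have "card ?A = card {l \<in> ?A. ga l \<noteq> l} + card (fixed x)"
      unfolding fixed_def using finite_lines
      by (subst card_Un_disjoint[symmetric]) (auto intro: arg_cong[of _ _ card])
    then have "t + 1 = p * j + card (fixed x)" using card_lines_on_point[OF x(1)] j by simp
    then have "(t + 1) mod p = card (fixed x) mod p" by simp
    then show ?thesis by simp
  qed
  let ?f = "(t + 1) mod p"
  have "0 < card (fixed x0)" using fixed_point[OF x0] large_rest by (cases "?f = 0") auto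
  then obtain l0 where l0: "l0 \<in> L" "ga l0 = l0" by (auto simp: card_gt_0_iff fixed_def)
  have yl0: "(y, l) \<notin> I" if "l \<in> L" "ga l = l" for l using fixed_line that y y_moved by blast
  have proj_unique: "v = v'"
    if "l \<in> L" "(x, l) \<notin> I" "x \<in> P" "v \<in> P" "k \<in> L" "(x, k) \<in> I" "(v, k) \<in> I" "(v, l) \<in> I"
      "v' \<in> P" "k' \<in> L" "(x, k') \<in> I" "(v', k') \<in> I" "(v', l) \<in> I" for x l v k v' k'
    using unique_projection[of x l] that by (metis (mono_tags, lifting) case_prod_conv prod.inject)
  have proj: "\<exists>v k. v \<in> P \<and> k \<in> L \<and> (x, k) \<in> I \<and> (v, k) \<in> I \<and> (v, l) \<in> I"
    if "l \<in> L" "(x, l) \<notin> I" "x \<in> P" for x l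
    using unique_projection[OF that(3,1,2)] by (auto elim!: ex1E)
  obtain u k0 where u: "u \<in> P" "k0 \<in> L" "(y, k0) \<in> I" "(u, k0) \<in> I" "(u, l0) \<in> I"
    using proj[OF l0(1) yl0[OF l0] y] by blast
  define Z where "Z = {z \<in> P. (z, l0) \<in> I} - {u}"
  have finZ: "finite Z" using finite_points by (simp add: Z_def)
  have "card Z = s" using u card_points_on_line[OF l0(1)] finite_points by (simp add: Z_def)
  define U where "U = (\<Union>z\<in>Z. fixed z - {l0})"
  have "s * (?f - 1) \<le> card U"
  proof -
    have "s * (?f - 1) = (\<Sum>z\<in>Z. ?f - 1)" using \<open>card Z = s\<close> by simp
    also have "\<dots> \<le> (\<Sum>z\<in>Z. card (fixed z - {l0}))"
    proof (rule sum_mono)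
      fix z assume z: "z \<in> Z"
      then have "l0 \<in> fixed z" using l0 by (simp add: Z_def fixed_def)
      moreover have "?f \<le> card (fixed z)" using fixed_point fixed_line l0 z by (simp add: Z_def)
      ultimately show "?f - 1 \<le> card (fixed z - {l0})" using fin_fixed by simp
    qed
    also have "\<dots> = card U"
      unfolding U_def
    proof (rule card_UN_disjoint[symmetric, OF finZ])
      show "\<forall>z\<in>Z. \<forall>z'\<in>Z. z \<noteq> z' \<longrightarrow> (fixed z - {l0}) \<inter> (fixed z' - {l0}) = {}"
        using at_most_one_line l0 by (fastforce simp: Z_def fixed_def)
    qed (use fin_fixed in auto)
    finally show ?thesis .
  qed
  have "\<forall>m\<in>U. \<exists>k v. v \<in> P \<and> k \<in> L \<and> (y, k) \<in> I \<and> (v, k) \<in> I \<and> (v, m) \<in> I"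
    using proj yl0 y by (fastforce simp: U_def fixed_def)
  then obtain k where "\<forall>m\<in>U. \<exists>v. v \<in> P \<and> k m \<in> L \<and> (y, k m) \<in> I \<and> (v, k m) \<in> I \<and> (v, m) \<in> I"
    by (auto dest!: bchoice)
  then obtain v where kv: "\<And>m. m \<in> U \<Longrightarrow> v m \<in> P \<and> k m \<in> L \<and> (y, k m) \<in> I \<and> (v m, k m) \<in> I \<and> (v m, m) \<in> I"
    by (auto dest!: bchoice)
  have U: "m \<in> L" "ga m = m" "m \<noteq> l0" "\<exists>z\<in>Z. (z, m) \<in> I" if "m \<in> U" for m
    using that by (auto simp: U_def fixed_def)
  have "inj_on k U"
  proof (rule inj_onI, rule ccontr)
    fix m m' assume m: "m \<in> U" "m' \<in> U" "k m = k m'" "m \<noteq> m'"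
    have v_fixed: "g (v n) = v n" if "n \<in> U" for n using fixed_line[OF U(1,2)] kv that by blast
    \<comment> \<open>Otherwise \<open>k m\<close> joins two fixed points, so it is fixed, and with it the point \<open>y\<close> on it.\<close>
    have vv: "v m = v m'"
    proof (rule ccontr)
      assume ne: "v m \<noteq> v m'"
      have "ga (k m) = k m"
        using at_most_one_line[of "v m" "v m'" "ga (k m)" "k m"] ne kv[OF m(1)] kv[OF m(2)]
          ga_iff[of "v m" "k m"] ga_iff[of "v m'" "k m"] gaL[of "k m"] v_fixed m by auto
      then show False using yl0 kv[OF m(1)] by blast
    qed
    obtain z z' where z: "z \<in> Z" "(z, m) \<in> I" "z' \<in> Z" "(z', m') \<in> I" using U(4) m by blast
    have zl: "z \<in> P" "(z, l0) \<in> I" "z \<noteq> u" "z' \<in> P" "(z', l0) \<in> I" "z' \<noteq> u"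
      using z by (auto simp: Z_def)
    have v0: "(v m, l0) \<notin> I"
    proof
      assume "(v m, l0) \<in> I"
      then have "v m = u"
        using proj_unique[OF l0(1) yl0[OF l0] y, of "v m" "k m" u k0] kv[OF m(1)] u by blast
      moreover have "v m = z"
        using at_most_one_point[OF l0(1) U(1)[OF m(1)]] U(3)[OF m(1)] kv[OF m(1)] z zl \<open>(v m, l0) \<in> I\<close>
        by blast
      ultimately show False using zl by blast
    qed
    \<comment> \<open>There is no triangle with vertices \<open>v m\<close>, \<open>z\<close> and \<open>z'\<close>.\<close>
    have "z = z'"
      using proj_unique[OF l0(1) v0, of z m z' m'] kv[OF m(1)] kv[OF m(2)] vv U(1) m z zl by metis
    then have "z = v m"
      using at_most_one_point[OF U(1)[OF m(1)] U(1)[OF m(2)] m(4)] kv[OF m(1)] kv[OF m(2)] vv z zl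
      by metis
    then show False using v0 zl by blast
  qed
  then have "card U \<le> card {l \<in> L. (y, l) \<in> I}"
    using kv finite_lines by (intro card_inj_on_le) auto
  then show False
    using card_lines_on_point[OF y] \<open>s * (?f - 1) \<le> card U\<close> large_rest by linarith
qed

end

section \<open>Groups of prime square order\<close>

text \<open>
  Right multiplication by \<open>a\<close> permutes the \<open>p\<close> right cosets of the subgroup generated by \<open>a\<close> and
  fixes the subgroup itself. Its other cosets are too few for a cycle of length \<open>p\<close>, so all are
  fixed, and that the coset of \<open>h\<close> is fixed is the claim.
\<close>

lemma (in group) prime_order_element_normal:
  assumes p: "prime p" and ord2: "Coset.order G = p\<^sup>2"
    and a: "a \<in> carrier G" "a [^] p = \<one>" and h: "h \<in> carrier G"
  shows "h \<otimes> a \<otimes> inv h \<in> generate G {a}"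
proof (cases "a = \<one>")
  case True
  then show ?thesis using h by (simp add: generate.one)
next
  case False
  let ?C = "generate G {a}"
  have C: "subgroup ?C G" using a by (intro generate_is_subgroup) simp
  have p0: "0 < p" using p by (rule prime_gt_0_nat)
  have "ord a dvd p" using a pow_eq_id by simp
  then have "ord a = p" using p False a ord_eq_1 by (metis prime_nat_iff)
  then have "card ?C = p" using generate_pow_card[OF a(1)] by simp
  then have nC: "card (rcosets ?C) = p"
    using lagrange[OF C] ord2 p0 by (simp add: power2_eq_square)
  have finC: "finite (rcosets ?C)" using nC p0 card_ge_0_finite by metis
  let ?r = "\<lambda>X. X #> a"
  have sub: "X \<subseteq> carrier G" if "X \<in> rcosets ?C" for X
    using rcosets_subset_PowG[OF C] that by blast
  have closed: "?r X \<in> rcosets ?C" if "X \<in> rcosets ?C" for X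
    using that a subgroup.subset[OF C] by (auto simp: RCOSETS_def coset_mult_assoc)
  have iter: "(?r ^^ k) X = X #> (a [^] k)" if "X \<in> rcosets ?C" for k X
    using sub[OF that] a by (induction k) (simp_all add: coset_mult_assoc)
  have "p dvd card {X \<in> rcosets ?C. ?r X \<noteq> X}"
    by (rule prime_dvd_card_moved_points[OF p finC closed])
      (use iter sub a in auto)
  moreover have "card {X \<in> rcosets ?C. ?r X \<noteq> X} < p"
  proof -
    have "?C \<in> rcosets ?C"
      using rcosetsI[OF subgroup.subset[OF C] one_closed] subgroup.subset[OF C] by simp
    moreover have "?C #> a = ?C" using a C by (intro coset_join2) (auto intro: generate.incl)
    ultimately have "{X \<in> rcosets ?C. ?r X \<noteq> X} \<subset> rcosets ?C" by blast
    then have "card {X \<in> rcosets ?C. ?r X \<noteq> X} < card (rcosets ?C)"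
      by (rule psubset_card_mono[OF finC])
    then show ?thesis unfolding nC .
  qed
  ultimately have "card {X \<in> rcosets ?C. ?r X \<noteq> X} = 0"
    using dvd_imp_le not_le by blast
  then have all_fixed: "X #> a = X" if "X \<in> rcosets ?C" for X
    using that finC by auto
  have "?C #> h #> a = ?C #> h" using all_fixed h C by (auto simp: RCOSETS_def)
  then have "?C #> (h \<otimes> a) = ?C #> h"
    using h a subgroup.subset[OF C] by (simp add: coset_mult_assoc)
  moreover have "h \<otimes> a \<in> ?C #> (h \<otimes> a)" using rcos_self[OF _ C] h a by simp
  ultimately obtain c where "c \<in> ?C" "h \<otimes> a = c \<otimes> h" by (auto simp: r_coset_def)
  moreover have "c \<in> carrier G" using \<open>c \<in> ?C\<close> subgroup.subset[OF C] by blast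
  ultimately show ?thesis using h by (simp add: m_assoc)
qed

text \<open>
  Conjugation by \<open>h\<close> permutes the subgroup \<open>C\<close> generated by \<open>a\<close>, which has at most \<open>p\<close> elements, and
  fixes \<open>\<one>\<close>; if its \<open>p\<close>-th power is trivial on \<open>C\<close>, it cannot have a cycle of length \<open>p\<close> and is trivial
  on \<open>C\<close> as well. Applied to \<open>h [^] p\<close> first, whose \<open>p\<close>-th power is \<open>\<one>\<close>, this then applies to \<open>h\<close>.
\<close>

lemma (in group) prime_order_element_central:
  assumes p: "prime p" and ord2: "Coset.order G = p\<^sup>2"
    and a: "a \<in> carrier G" "a [^] p = \<one>" and h: "h \<in> carrier G"
  shows "h \<otimes> a = a \<otimes> h"
proof -
  let ?C = "generate G {a}"
  have C: "subgroup ?C G" using a by (intro generate_is_subgroup) simp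
  have CG: "c \<in> carrier G" if "c \<in> ?C" for c using subgroup.subset[OF C] that by blast
  have p0: "0 < p" using p by (rule prime_gt_0_nat)
  have "0 < Coset.order G" using ord2 p0 by simp
  then have fin: "finite (carrier G)" by (simp add: order_gt_0_iff_finite)
  have finC: "finite ?C" by (rule finite_subset[OF subgroup.subset[OF C] fin])
  have "ord a dvd p" using a pow_eq_id by simp
  then have "card ?C \<le> p" using generate_pow_card[OF a(1)] p0 by (simp add: dvd_imp_le)
  have conj_closed: "b \<otimes> c \<otimes> inv b \<in> ?C" if c: "c \<in> ?C" and b: "b \<in> carrier G" for b c
  proof -
    obtain i :: int where i: "c = a [^] i" using c generate_pow[OF a(1)] by blast
    have "c [^] p = (a [^] i) [^] int p" by (simp add: i int_pow_int)
    also have "\<dots> = (a [^] int p) [^] i"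
      using int_pow_pow[OF a(1), of i "int p"] int_pow_pow[OF a(1), of "int p" i]
      by (simp only: mult.commute)
    also have "\<dots> = \<one>" using a by (simp add: int_pow_int)
    finally have "c [^] p = \<one>" .
    then have "b \<otimes> c \<otimes> inv b \<in> generate G {c}"
      using prime_order_element_normal[OF p ord2 CG[OF c] _ b] by blast
    moreover have "generate G {c} \<subseteq> ?C" using c C by (intro generate_subgroup_incl) auto
    ultimately show ?thesis by blast
  qed
  have commutes: "b \<otimes> c = c \<otimes> b"
    if b: "b \<in> carrier G" and bp: "\<And>c. c \<in> ?C \<Longrightarrow> b [^] p \<otimes> c = c \<otimes> b [^] p" and c: "c \<in> ?C" for b c
  proof -
    let ?r = "\<lambda>c. b \<otimes> c \<otimes> inv b"
    have iter: "(?r ^^ k) c = b [^] k \<otimes> c \<otimes> inv (b [^] k)" if "c \<in> carrier G" for k c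
    proof (induction k)
      case (Suc k)
      have "b [^] Suc k = b \<otimes> b [^] k" using b by (metis nat_pow_Suc nat_pow_Suc2)
      then show ?case using Suc that b by (simp add: m_assoc inv_mult_group del: nat_pow_Suc)
    qed (use that in simp)
    have "p dvd card {c \<in> ?C. ?r c \<noteq> c}"
    proof (rule prime_dvd_card_moved_points[OF p finC])
      show "(?r ^^ p) c = c" if "c \<in> ?C" for c
        unfolding iter[OF CG[OF that]] bp[OF that] using CG[OF that] b by (simp add: m_assoc)
    qed (use conj_closed b in auto)
    moreover have "card {c \<in> ?C. ?r c \<noteq> c} < p"
    proof -
      have "\<one> \<in> ?C" by (rule generate.one)
      moreover have "?r \<one> = \<one>" using b by simp
      ultimately have "{c \<in> ?C. ?r c \<noteq> c} \<subset> ?C" by blast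
      then have "card {c \<in> ?C. ?r c \<noteq> c} < card ?C" by (rule psubset_card_mono[OF finC])
      then show ?thesis using \<open>card ?C \<le> p\<close> by (rule order.strict_trans2)
    qed
    ultimately have "card {c \<in> ?C. ?r c \<noteq> c} = 0"
    using dvd_imp_le not_le by blast
    then have "?r c = c" using c finC by auto
    then show ?thesis using b CG[OF c] by (metis inv_solve_right m_closed)
  qed
  have hpp: "(h [^] p) [^] p = \<one>"
    using h ord2 pow_order_eq_1[OF h] by (simp add: nat_pow_pow power2_eq_square)
  have hp: "h [^] p \<otimes> c = c \<otimes> h [^] p" if "c \<in> ?C" for c
    using commutes[of "h [^] p" c] h hpp CG that by simp
  show ?thesis by (rule commutes[OF h hp generate.incl]) simp_all
qed

text \<open>
  An element of order \<open>p\<^sup>2\<close> generates the group; all others are central.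
\<close>

theorem (in group) prime_square_order_imp_comm_group:
  assumes p: "prime p" and ord2: "Coset.order G = p\<^sup>2"
  shows "comm_group G"
proof (rule group_comm_groupI)
  fix a b assume a: "a \<in> carrier G" and b: "b \<in> carrier G"
  have p0: "0 < p" using p by (rule prime_gt_0_nat)
  have "0 < Coset.order G" using ord2 p0 by simp
  then have fin: "finite (carrier G)" by (simp add: order_gt_0_iff_finite)
  show "a \<otimes> b = b \<otimes> a"
  proof (cases "a [^] p = \<one>")
    case True
    then show ?thesis using prime_order_element_central[OF p ord2 a _ b] by simp
  next
    case False
    have "ord a dvd p\<^sup>2" using ord_dvd_group_order[OF a] ord2 by simp
    then obtain i where i: "i \<le> 2" "ord a = p ^ i" using divides_primepow_nat[OF p] by blast
    have "\<not> ord a dvd p" using False a pow_eq_id by simp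
    then have "i = 2" using i by (cases "i = 0 \<or> i = 1") auto
    then have "card (generate G {a}) = card (carrier G)"
      using i generate_pow_card[OF a] ord2 by (simp add: Coset.order_def)
    then have "generate G {a} = carrier G"
      using generate_incl[of "{a}"] a fin by (intro card_subset_eq) auto
    then obtain j :: int where j: "b = a [^] j" using b generate_pow[OF a] by blast
    have "a \<otimes> a [^] j = a [^] (1 + j)" using a int_pow_mult[OF a, of 1 j] by simp
    also have "\<dots> = a [^] j \<otimes> a" using a int_pow_mult[OF a, of j 1] by (simp add: add.commute)
    finally show ?thesis by (simp add: j)
  qed
qed

section \<open>Automorphism groups of quadrangles of order (4,12)\<close>

lemma (in transitive_action) card_dvd_order:
  assumes "E \<noteq> {}"
  shows "card E dvd Coset.order G"
proof -
  obtain x where x: "x \<in> E" using assms by blast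
  have "orbit G \<phi> x = E"
    using unique_orbit[OF x] element_image x by (auto simp: orbit_def)
  then show ?thesis using orbit_stabilizer_theorem[OF x] by (metis dvd_triv_left)
qed

lemma finite_automorphisms:
  assumes "finite P"
  shows "finite (automorphisms P L I)"
proof (rule finite_subset)
  show "automorphisms P L I \<subseteq> P \<rightarrow>\<^sub>E P"
    by (auto simp: automorphisms_def Bij_def PiE_def bij_betw_def)
  show "finite (P \<rightarrow>\<^sub>E P)" using assms by (simp add: finite_PiE)
qed

text \<open>
  The group is abelian. It acts freely: if \<open>g\<close> fixes a point then \<open>g [^] 7\<close>, whose seventh power is
  trivial, fixes it as well and so is trivial; then the same holds for \<open>g\<close>.
\<close>

lemma (in generalized_quadrangle) no_automorphism_subgroup_of_order_49:
  assumes st: "s = 4" "t = 12" and H: "subgroup H (aut_group P L I)" and cH: "card H = 49"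
  shows False
proof -
  let ?S = "aut_group P L I\<lparr>carrier := H\<rparr>"
  have HA: "H \<subseteq> automorphisms P L I" using subgroup.subset[OF H] by (simp add: aut_group_def)
  have grp: "group ?S" by (rule subgroup.subgroup_is_group[OF H group_aut_group])
  have ord: "Coset.order ?S = 7\<^sup>2" using cH by (simp add: Coset.order_def)
  have p7: "prime (7 :: nat)" by simp
  interpret S: comm_group ?S
    by (rule group.prime_square_order_imp_comm_group[OF grp p7 ord])
  have aut: "g \<in> Bij P" "bij_betw g P P" "\<And>x. x \<in> P \<Longrightarrow> g x \<in> P" if "g \<in> H" for g
    using HA that by (auto simp: automorphisms_def Bij_def bij_betw_def)
  have mult: "(g \<otimes>\<^bsub>?S\<^esub> h) x = g (h x)" if "g \<in> H" "h \<in> H" "x \<in> P" for g h x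
    using aut that by (simp add: aut_group_def BijGroup_def compose_eq)
  have one: "\<one>\<^bsub>?S\<^esub> = (\<lambda>x\<in>P. x)" by (simp add: aut_group_def BijGroup_def)
  have pow: "g [^]\<^bsub>?S\<^esub> k \<in> H \<and> (\<forall>x\<in>P. (g [^]\<^bsub>?S\<^esub> k) x = (g ^^ k) x)" if g: "g \<in> H" for g and k :: nat
  proof (induction k)
    case 0
    have "\<one>\<^bsub>?S\<^esub> \<in> H" "\<forall>x\<in>P. \<one>\<^bsub>?S\<^esub> x = x" using S.one_closed by (simp_all add: one)
    then show ?case by simp
  next
    case (Suc k)
    have "(g [^]\<^bsub>?S\<^esub> Suc k) x = (g ^^ Suc k) x" if "x \<in> P" for x
      using Suc g that mult[of "g [^]\<^bsub>?S\<^esub> k" g x] aut(3)[OF g] by (simp add: funpow_swap1)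
    then show ?case using S.nat_pow_closed[of g "Suc k"] g by simp
  qed
  have fixes_all: "g y = y"
    if "g \<in> H" "\<And>x. x \<in> P \<Longrightarrow> (g ^^ 7) x = x" "x \<in> P" "g x = x" "y \<in> P" for g x y
    by (rule automorphism_eq_id_of_large_prime_order[OF _ p7]) (use that HA st in auto)
  have free: "g = \<one>\<^bsub>?S\<^esub>" if g: "g \<in> H" and x: "x \<in> P" "g x = x" for g x
  proof -
    let ?h = "g [^]\<^bsub>?S\<^esub> (7 :: nat)"
    have hH: "?h \<in> H" using pow g by blast
    have "?h [^]\<^bsub>?S\<^esub> (7 :: nat) = \<one>\<^bsub>?S\<^esub>"
      using S.pow_order_eq_1[of g] g ord by (simp add: S.nat_pow_pow)
    then have "(?h ^^ 7) y = y" if "y \<in> P" for y using pow[OF hH, of 7] that by (simp add: one)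
    moreover have "(g ^^ k) x = x" for k using x(2) by (induction k) auto
    then have "?h x = x" using pow[OF g, of 7] x by simp
    ultimately have "?h y = y" if "y \<in> P" for y using fixes_all[OF hH _ x(1)] that by blast
    then have "(g ^^ 7) y = y" if "y \<in> P" for y using pow[OF g, of 7] that by simp
    then have "g y = y" if "y \<in> P" for y using fixes_all[OF g _ x] that by blast
    then show ?thesis using aut(1)[OF g] by (auto simp: one Bij_def extensional_def fun_eq_iff)
  qed
  have inj: "g x = g y \<longleftrightarrow> x = y" if "g \<in> H" "x \<in> P" "y \<in> P" for g x y
    using aut(2)[OF that(1)] that by (auto simp: bij_betw_def inj_on_def)
  have "invariant_kernel ?S P (\<lambda>g. g) eigenspace_kernel 80"
  proof unfold_locales
    show "finite (carrier ?S)" using cH card_ge_0_finite[of H] by simp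
    show "eigenspace_kernel x y = eigenspace_kernel y x" if "x \<in> P" "y \<in> P" for x y
      by (auto simp: eigenspace_kernel_def collinear_def)
    show "eigenspace_kernel (g x) (g y) = eigenspace_kernel x y" if "g \<in> carrier ?S" "x \<in> P" "y \<in> P" for g x y
      using that HA inj by (auto simp: eigenspace_kernel_def automorphisms_def)
    show "(\<Sum>y\<in>P. eigenspace_kernel x y * eigenspace_kernel y z) = 80 * eigenspace_kernel x z" if "x \<in> P" "z \<in> P" for x z
      using eigenspace_kernel_square[OF that] st by simp
  qed (use finite_points aut(3) mult one free in auto)
  then show False
  proof (rule invariant_kernel.no_kernel_with_values_16_m4_1)
    show "card P = 245" using card_points st by simp
    show "eigenspace_kernel x x = 16" for x unfolding eigenspace_kernel_def using st by simp
    show "eigenspace_kernel x y = 1 \<or> eigenspace_kernel x y = -4" if "x \<noteq> y" for x y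
      unfolding eigenspace_kernel_def using st that by simp
  qed (use ord in simp_all)
qed

theorem theorem1p6:
  fixes P :: "'p set" and L :: "'l set" and I :: "('p \<times> 'l) set"
  assumes "generalized_quadrangle P L I 4 12"
  shows "\<not> transitive_action (aut_group P L I) P (\<lambda>g. g) \<and>
    \<not> transitive_action (aut_group P L I) L (line_action P L I)"
proof -
  interpret generalized_quadrangle P L I 4 12 by (rule assms)
  let ?G = "aut_group P L I"
  have fin: "finite (carrier ?G)"
    using finite_automorphisms[OF finite_points] by (simp add: aut_group_def)
  have cP: "card P = 245" using card_points by simp
  have cL: "card L = 637" using card_flags cP by simp
  have no_49: "\<not> 49 dvd Coset.order ?G"
  proof
    assume "49 dvd Coset.order ?G"
    then obtain m where "Coset.order ?G = 7 ^ 2 * m" by (auto elim: dvdE)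
    then obtain H where "subgroup H ?G" "card H = 7 ^ 2"
      using sylow_thm[of 7 ?G 2 m] group_aut_group fin by auto
    then show False using no_automorphism_subgroup_of_order_49 by simp
  qed
  show ?thesis
  proof (intro conjI notI)
    assume "transitive_action ?G P (\<lambda>g. g)"
    then have "card P dvd Coset.order ?G"
      using points_nonempty by (rule transitive_action.card_dvd_order)
    then show False using no_49 cP dvd_trans[of "49 :: nat" 245] by simp
  next
    assume "transitive_action ?G L (line_action P L I)"
    moreover have "L \<noteq> {}" using cL by auto
    ultimately have "card L dvd Coset.order ?G" by (rule transitive_action.card_dvd_order)
    then show False using no_49 cL dvd_trans[of "49 :: nat" 637] by simp
  qed
qed

end
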